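(* Given $\alpha>0$, there exist a Banach space $X_\alpha$ and a bounded $C_0$-semigroup $(T(t))_{t\ge0}$ on $X_\alpha$ with generator $A$ such that (a) $\|R(is,A)\|=O(|s|^{\alpha})$ as $|s|\to\infty$ ($s\in\mathbb{R}$), and (b) $\displaystyle\limsup_{t\to\infty}\Bigl(\frac{t}{\log t}\Bigr)^{1/\alpha}\|T(t)A^{-1}\|>0.$
   Context: Banach spaces are complex. $R(\lambda,A)=(\lambda-A)^{-1}$ denotes the resolvent of $A$. Bounded semigroup means $\sup_{t\ge0}\|T(t)\|<\infty$. It is part of the assertions that the resolvents and the inverse appearing in (a) and (b) exist as bounded operators. *)

theory Defs
  imports
    "HOL-Analysis.Analysis"
    "HOL-Library.Landau_Symbols"
    "HOL-Library.Function_Algebras"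
begin

text \<open>
  The type classes for normed spaces are real, and HOL cannot quantify existentially over types.
  Complex Banach spaces are therefore linear subspaces of an ambient complex vector space (a type
  with its own addition and a given scalar multiplication), with a norm whose values matter only on
  the subspace. The ambient type \<open>real \<Rightarrow> complex\<close>, with pointwise addition, contains a copy of every
  complex vector space of dimension at most that of all complex functions on the real line.
\<close>

record 'a cspace =
  vecs :: "'a set"
  smul :: "complex \<Rightarrow> 'a \<Rightarrow> 'a"
  nrm :: "'a \<Rightarrow> real"

locale complex_banach_space = vector_space "smul E" for E :: "'a::ab_group_add cspace" +
  assumes subspace_vecs: "subspace (vecs E)"
    and nrm_eq_0_iff: "x \<in> vecs E \<Longrightarrow> nrm E x = 0 \<longleftrightarrow> x = 0"
    and nrm_triangle: "x \<in> vecs E \<Longrightarrow> y \<in> vecs E \<Longrightarrow> nrm E (x + y) \<le> nrm E x + nrm E y"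
    and nrm_smul: "x \<in> vecs E \<Longrightarrow> nrm E (smul E c x) = cmod c * nrm E x"
    and nrm_complete:
      "(\<And>n::nat. u n \<in> vecs E) \<Longrightarrow>
       (\<And>e. e > 0 \<Longrightarrow> \<exists>N. \<forall>m\<ge>N. \<forall>n\<ge>N. nrm E (u m - u n) < e) \<Longrightarrow>
       \<exists>x\<in>vecs E. (\<lambda>n. nrm E (u n - x)) \<longlonglongrightarrow> 0"

definition bounded_op :: "'a::ab_group_add cspace \<Rightarrow> ('a \<Rightarrow> 'a) \<Rightarrow> bool" where
  "bounded_op E B \<longleftrightarrow>
     (\<forall>x\<in>vecs E. B x \<in> vecs E) \<and>
     (\<forall>x\<in>vecs E. \<forall>y\<in>vecs E. B (x + y) = B x + B y) \<and>
     (\<forall>c. \<forall>x\<in>vecs E. B (smul E c x) = smul E c (B x)) \<and>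
     (\<exists>K. \<forall>x\<in>vecs E. nrm E (B x) \<le> K * nrm E x)"

text \<open>The operator norm; meaningful only for bounded operators, since \<open>Sup\<close> is real-valued.\<close>

definition op_norm :: "'a cspace \<Rightarrow> ('a \<Rightarrow> 'a) \<Rightarrow> real" where
  "op_norm E B = (SUP x\<in>{x \<in> vecs E. nrm E x \<le> 1}. nrm E (B x))"

definition C0_semigroup :: "'a::ab_group_add cspace \<Rightarrow> (real \<Rightarrow> 'a \<Rightarrow> 'a) \<Rightarrow> bool" where
  "C0_semigroup E T \<longleftrightarrow>
     (\<forall>t\<ge>0. bounded_op E (T t)) \<and>
     (\<forall>x\<in>vecs E. T 0 x = x) \<and>
     (\<forall>s\<ge>0. \<forall>t\<ge>0. \<forall>x\<in>vecs E. T (s + t) x = T s (T t x)) \<and>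
     (\<forall>x\<in>vecs E. ((\<lambda>t. nrm E (T t x - x)) \<longlongrightarrow> 0) (at_right 0))"

definition bounded_C0_semigroup :: "'a::ab_group_add cspace \<Rightarrow> (real \<Rightarrow> 'a \<Rightarrow> 'a) \<Rightarrow> bool" where
  "bounded_C0_semigroup E T \<longleftrightarrow>
     C0_semigroup E T \<and> bdd_above ((\<lambda>t. op_norm E (T t)) ` {0..})"

definition has_generator_value ::
    "'a::ab_group_add cspace \<Rightarrow> (real \<Rightarrow> 'a \<Rightarrow> 'a) \<Rightarrow> 'a \<Rightarrow> 'a \<Rightarrow> bool" where
  "has_generator_value E T x y \<longleftrightarrow> y \<in> vecs E \<and>
     ((\<lambda>h. nrm E (smul E (complex_of_real (1 / h)) (T h x - x) - y)) \<longlongrightarrow> 0) (at_right 0)"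

definition generator_domain :: "'a::ab_group_add cspace \<Rightarrow> (real \<Rightarrow> 'a \<Rightarrow> 'a) \<Rightarrow> 'a set" where
  "generator_domain E T = {x \<in> vecs E. \<exists>y. has_generator_value E T x y}"

definition generator :: "'a::ab_group_add cspace \<Rightarrow> (real \<Rightarrow> 'a \<Rightarrow> 'a) \<Rightarrow> 'a \<Rightarrow> 'a" where
  "generator E T x = (THE y. has_generator_value E T x y)"

text \<open>
  An unbounded operator is a function \<open>A\<close> together with its domain \<open>D\<close>. Its inverse is
  \<open>the_inv_into D A\<close>, and it has to be everywhere defined and bounded.
\<close>

definition has_bounded_inverse :: "'a::ab_group_add cspace \<Rightarrow> 'a set \<Rightarrow> ('a \<Rightarrow> 'a) \<Rightarrow> bool" where
  "has_bounded_inverse E D A \<longleftrightarrow> bij_betw A D (vecs E) \<and> bounded_op E (the_inv_into D A)"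

definition resolvent_set :: "'a::ab_group_add cspace \<Rightarrow> 'a set \<Rightarrow> ('a \<Rightarrow> 'a) \<Rightarrow> complex set" where
  "resolvent_set E D A = {z. has_bounded_inverse E D (\<lambda>x. smul E z x - A x)}"

definition resolvent ::
    "'a::ab_group_add cspace \<Rightarrow> 'a set \<Rightarrow> ('a \<Rightarrow> 'a) \<Rightarrow> complex \<Rightarrow> 'a \<Rightarrow> 'a" where
  "resolvent E D A z = the_inv_into D (\<lambda>x. smul E z x - A x)"

end

theory Submission
  imports Defs
begin

text \<open>
  The semigroup is a direct sum of finite blocks, one for each frequency \<open>\<nu> = 1, 2, 3, \<dots>\<close>. A block
  consists of vectors \<open>a\<^sub>0, \<dots>, a\<^sub>K\<close>, and with the left shift \<open>(U a)\<^sub>k = a\<^sub>k\<^sub>+\<^sub>1\<close> the generator acts on it as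
  \<open>A = \<i> \<nu> + \<nu> (U - 1)\<close>. Hence \<open>T(t)\<close> is a rotation by \<open>\<i> \<nu> t\<close> times the average of the powers of \<open>U\<close>
  under the Poisson distribution with mean \<open>\<nu> t\<close>, a contraction for every norm for which \<open>U\<close> is one.

  The norm of a block is the larger of the supremum norm and the weighted sum
  \<open>\<eta> \<Sum>\<^sub>k (1 + \<eta>)\<^sup>k \<bar>a\<^sub>k\<bar>\<close> with \<open>\<eta> = \<nu>\<^sup>-\<^sup>1\<^sup>-\<^sup>\<alpha>\<close>. The weighted sum controls the resolvent: for it, \<open>U\<close> has norm
  at most \<open>1 / (1 + \<eta>)\<close>, so the resolvent has order at most \<open>1 / (\<nu> \<eta>) = \<nu>\<^sup>\<alpha>\<close> on the imaginary axis. For the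
  supremum norm, where \<open>U\<close> has norm 1, this argument gives nothing; but the resolvent is at most \<open>1 / \<nu>\<close>
  times the plain sum of the \<open>\<bar>a\<^sub>k\<bar>\<close>, which is at most \<open>1 / \<eta>\<close> times the weighted sum, and this gives
  \<open>\<nu>\<^sup>\<alpha>\<close> again (\<open>bnorm_R_le\<close>). For \<open>\<bar>s\<bar> \<le> \<nu> / 2\<close> the point \<open>\<i> s\<close> has a distance of order \<open>\<nu>\<close> from the disc of
  radius \<open>\<nu>\<close> around \<open>\<i> \<nu> - \<nu>\<close>, so the resolvent of the block is uniformly bounded there
  (\<open>bnorm_R_le_off_resonance\<close>). Only blocks with \<open>\<nu> < 2 \<bar>s\<bar>\<close> can resonate with \<open>\<i> s\<close>, whence (a).

  In supremum norm nothing decays: a wave packet around \<open>k = \<nu> t\<close>, of the width \<open>sqrt (\<nu> t)\<close> of the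
  Poisson distribution, is carried to \<open>k = 0\<close> in time \<open>t\<close> and still has height at least \<open>1/2\<close> there. The
  price is the weighted sum of the packet, of order \<open>\<eta> sqrt (\<nu> t)\<close> times a power of \<open>exp (\<eta> \<nu> t)\<close>.
  Since \<open>\<eta> \<nu> t = \<nu>\<^sup>-\<^sup>\<alpha> t\<close>, the exponential only contributes a small power of \<open>\<nu>\<close> as long as \<open>t\<close> is at
  most a small multiple of \<open>\<nu>\<^sup>\<alpha> log \<nu>\<close>, and the narrowness of the packet compensates for it. This is
  where the logarithm comes from. The generator enlarges the packet at most by a
  factor of order \<open>\<nu>\<close>, so \<open>\<parallel>T(t) A\<^sup>-\<^sup>1\<parallel> \<ge> c / \<nu>\<close> for \<open>t = \<nu>\<^sup>\<alpha> log \<nu> / 8\<close> (\<open>op_norm_T_inverse_ge\<close>), and \<open>\<nu>\<close> is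
  of order \<open>(t / log t)\<^sup>1\<^sup>/\<^sup>\<alpha>\<close>.

  Within the direct sum, all operators are power series in \<open>U\<close> with coefficients depending on the
  block, so identities between them are identities of formal power series. Vectors
  living on finitely many blocks are dense, and on them limits can be taken coefficientwise; the
  generator is found there and extended by its closedness (\<open>generator_closed\<close>).
\<close>

unbundle no vec_syntax
unbundle fps_syntax

section \<open>Semigroups on complex Banach spaces\<close>

context complex_banach_space
begin

lemma vecs_closed [simp, intro]:
  shows "0 \<in> vecs E"
    and "x \<in> vecs E \<Longrightarrow> y \<in> vecs E \<Longrightarrow> x + y \<in> vecs E"
    and "x \<in> vecs E \<Longrightarrow> y \<in> vecs E \<Longrightarrow> x - y \<in> vecs E"
    and "x \<in> vecs E \<Longrightarrow> smul E c x \<in> vecs E"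
  using subspace_vecs by (auto intro: subspace_0 subspace_add subspace_diff subspace_scale)

lemma nrm_zero [simp]: "nrm E 0 = 0"
  using nrm_eq_0_iff[of 0] by simp

lemma nrm_minus: "x \<in> vecs E \<Longrightarrow> nrm E (- x) = nrm E x"
  using nrm_smul[of x "- 1"] by simp

lemma nrm_diff_le: "x \<in> vecs E \<Longrightarrow> y \<in> vecs E \<Longrightarrow> nrm E (x - y) \<le> nrm E x + nrm E y"
  using nrm_triangle[of x "- y"] nrm_minus[of y] subspace_neg[OF subspace_vecs, of y] by simp

lemma nrm_minus_commute: "x \<in> vecs E \<Longrightarrow> y \<in> vecs E \<Longrightarrow> nrm E (x - y) = nrm E (y - x)"
  using nrm_minus[of "x - y"] by simp

lemma nrm_nonneg: "x \<in> vecs E \<Longrightarrow> 0 \<le> nrm E x"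
  using nrm_diff_le[of x x] by simp

lemma nrm_le_add_diff: "x \<in> vecs E \<Longrightarrow> y \<in> vecs E \<Longrightarrow> nrm E x \<le> nrm E y + nrm E (x - y)"
  using nrm_triangle[of y "x - y"] by simp

lemma abs_nrm_diff_le:
  "x \<in> vecs E \<Longrightarrow> y \<in> vecs E \<Longrightarrow> \<bar>nrm E x - nrm E y\<bar> \<le> nrm E (x - y)"
  using nrm_le_add_diff[of x y] nrm_le_add_diff[of y x] nrm_minus_commute[of x y] by simp

lemma nrm_divide:
  assumes "x \<in> vecs E" "0 < h"
  shows "nrm E (smul E (complex_of_real (1 / h)) x) = nrm E x / h"
  using assms by (subst nrm_smul) (simp_all only: norm_of_real, simp)

lemma op_norm_le:
  assumes "\<And>x. x \<in> vecs E \<Longrightarrow> nrm E (B x) \<le> C * nrm E x" "0 \<le> C"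
  shows "op_norm E B \<le> C"
  unfolding op_norm_def
proof (rule cSUP_least)
  show "{x \<in> vecs E. nrm E x \<le> 1} \<noteq> {}"
    by (auto intro!: exI[of _ 0])
  fix x assume x: "x \<in> {x \<in> vecs E. nrm E x \<le> 1}"
  then have "nrm E (B x) \<le> C * nrm E x"
    using assms(1) by simp
  also have "\<dots> \<le> C"
    using x assms(2) by (simp add: mult_left_le)
  finally show "nrm E (B x) \<le> C" .
qed

lemma bdd_above_op_norm:
  assumes "bounded_op E B"
  shows "bdd_above ((\<lambda>x. nrm E (B x)) ` {x \<in> vecs E. nrm E x \<le> 1})"
proof -
  obtain K where K: "\<And>x. x \<in> vecs E \<Longrightarrow> nrm E (B x) \<le> K * nrm E x"
    using assms unfolding bounded_op_def by blast
  show ?thesis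
  proof (rule bdd_aboveI2)
    fix z assume z: "z \<in> {x \<in> vecs E. nrm E x \<le> 1}"
    then have "nrm E (B z) \<le> K * nrm E z" "0 \<le> nrm E z"
      using K nrm_nonneg by auto
    moreover have "K * nrm E z \<le> \<bar>K\<bar> * nrm E z"
      using \<open>0 \<le> nrm E z\<close> by (intro mult_right_mono) auto
    ultimately have "nrm E (B z) \<le> \<bar>K\<bar> * nrm E z"
      by linarith
    also have "\<dots> \<le> \<bar>K\<bar>"
      using z by (simp add: mult_left_le)
    finally show "nrm E (B z) \<le> \<bar>K\<bar>" .
  qed
qed

lemma op_norm_nonneg:
  assumes B: "bounded_op E B"
  shows "0 \<le> op_norm E B"
proof -
  have "0 \<le> nrm E (B 0)"
    using B by (intro nrm_nonneg) (auto simp: bounded_op_def)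
  also have "\<dots> \<le> op_norm E B"
    unfolding op_norm_def by (intro cSUP_upper bdd_above_op_norm[OF B]) auto
  finally show ?thesis .
qed

lemma le_op_norm:
  assumes B: "bounded_op E B" and x: "x \<in> vecs E"
  shows "nrm E (B x) \<le> op_norm E B * nrm E x"
proof -
  obtain K where K: "\<And>x. x \<in> vecs E \<Longrightarrow> nrm E (B x) \<le> K * nrm E x"
    using B unfolding bounded_op_def by blast
  have Bm: "\<And>x. x \<in> vecs E \<Longrightarrow> B x \<in> vecs E"
    and Bs: "\<And>c x. x \<in> vecs E \<Longrightarrow> B (smul E c x) = smul E c (B x)"
    using B by (auto simp: bounded_op_def)
  show ?thesis
  proof (cases "nrm E x = 0")
    case True
    then show ?thesis
      using K[OF x] by simp
  next
    case False
    then have pos: "nrm E x > 0"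
      using nrm_nonneg[OF x] by simp
    define y where "y = smul E (complex_of_real (1 / nrm E x)) x"
    have y: "y \<in> vecs E" "nrm E y = 1"
      using x pos by (auto simp: y_def nrm_smul norm_divide)
    have "nrm E (B y) \<le> op_norm E B"
      unfolding op_norm_def using y by (intro cSUP_upper bdd_above_op_norm[OF B]) auto
    moreover have "nrm E (B y) = nrm E (B x) / nrm E x"
      using pos by (simp add: y_def Bs x nrm_smul Bm norm_divide)
    ultimately show ?thesis
      using pos by (simp add: field_simps)
  qed
qed

lemma has_generator_value_unique:
  assumes T: "C0_semigroup E T" and x: "x \<in> vecs E"
    and y: "has_generator_value E T x y" and z: "has_generator_value E T x z"
  shows "y = z"
proof -
  let ?q = "\<lambda>h. smul E (complex_of_real (1 / h)) (T h x - x)"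
  have yz: "y \<in> vecs E" "z \<in> vecs E"
    using y z by (auto simp: has_generator_value_def)
  have "((\<lambda>h. nrm E (?q h - y) + nrm E (?q h - z)) \<longlongrightarrow> 0 + 0) (at_right 0)"
    using y z by (intro tendsto_add) (auto simp: has_generator_value_def)
  moreover have "\<forall>\<^sub>F h in at_right 0. nrm E (y - z) \<le> nrm E (?q h - y) + nrm E (?q h - z)"
    using eventually_at_right_less[of "0::real"]
  proof eventually_elim
    case (elim h)
    have "T h x \<in> vecs E"
      using T x elim by (auto simp: C0_semigroup_def bounded_op_def)
    then have q: "?q h \<in> vecs E"
      using x by blast
    show ?case
      using nrm_diff_le[of "?q h - z" "?q h - y"] q yz by simp
  qed
  ultimately have "nrm E (y - z) \<le> 0 + 0"
    by (intro tendsto_lowerbound) (auto simp: trivial_limit_at_right_real)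
  then have "nrm E (y - z) = 0"
    using nrm_nonneg[of "y - z"] yz by simp
  then show ?thesis
    using nrm_eq_0_iff[of "y - z"] yz by simp
qed

lemma generator_eqI:
  assumes "C0_semigroup E T" "x \<in> vecs E" "has_generator_value E T x y"
  shows "generator E T x = y"
  unfolding generator_def using assms by (blast intro: has_generator_value_unique)

text \<open>
  This is the mean value inequality for \<open>t \<mapsto> T(t) x\<close>, obtained without integration: \<open>T(h) x - x\<close> is a
  sum of \<open>n\<close> translates \<open>T(j h / n) (T(h / n) x - x)\<close>, each of which is at most about \<open>M \<parallel>y\<parallel> h / n\<close>.
\<close>

lemma nrm_orbit_diff_le:
  assumes T: "C0_semigroup E T" and M: "\<And>t x. 0 \<le> t \<Longrightarrow> x \<in> vecs E \<Longrightarrow> nrm E (T t x) \<le> M * nrm E x"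
    and x: "x \<in> vecs E" and y: "has_generator_value E T x y" and h: "0 < h"
  shows "nrm E (T h x - x) \<le> M * h * nrm E y"
proof -
  have Tv: "T t z \<in> vecs E" if "0 \<le> t" "z \<in> vecs E" for t z
    using T that by (auto simp: C0_semigroup_def bounded_op_def)
  have yv: "y \<in> vecs E"
    using y by (simp add: has_generator_value_def)
  have Tadd: "T t (z + w) = T t z + T t w" if "0 \<le> t" "z \<in> vecs E" "w \<in> vecs E" for t z w
    using T that by (auto simp: C0_semigroup_def bounded_op_def)
  have steps: "nrm E (T (real m * d) x - x) \<le> real m * (M * nrm E (T d x - x))" if d: "0 < d" for m d
  proof (induction m)
    case 0
    then show ?case
      using T x by (simp add: C0_semigroup_def)
  next
    case (Suc m)
    let ?s = "real m * d"
    have s: "0 \<le> ?s"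
      using d by simp
    have "T (real (Suc m) * d) x = T (?s + d) x"
      by (simp add: algebra_simps)
    also have "\<dots> = T ?s (T d x)"
      using T x s d by (simp add: C0_semigroup_def)
    also have "\<dots> = T ?s (T d x - x) + T ?s x"
      using Tadd[OF s, of "T d x - x" x] x d by (simp add: Tv)
    finally have "T (real (Suc m) * d) x - x = T ?s (T d x - x) + (T ?s x - x)"
      by simp
    moreover have "T ?s (T d x - x) \<in> vecs E" "T ?s x - x \<in> vecs E"
      using x d s by (auto simp: Tv)
    ultimately have "nrm E (T (real (Suc m) * d) x - x) \<le> nrm E (T ?s (T d x - x)) + nrm E (T ?s x - x)"
      by (simp only: nrm_triangle)
    also have "\<dots> \<le> M * nrm E (T d x - x) + real m * (M * nrm E (T d x - x))"
      using M[OF s, of "T d x - x"] Suc x d by (intro add_mono) (auto simp: Tv)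
    finally show ?case
      by (simp add: algebra_simps)
  qed
  let ?q = "\<lambda>h. smul E (complex_of_real (1 / h)) (T h x - x)"
  have lim0: "filterlim (\<lambda>n. h / real (Suc n)) (at_right 0) sequentially"
    unfolding filterlim_at using h LIMSEQ_Suc[OF lim_const_over_n[of h]] by simp
  have ev: "\<forall>\<^sub>F d in at_right 0. \<bar>nrm E (?q d) - nrm E y\<bar> \<le> nrm E (?q d - y)"
    using eventually_at_right_less[of "0::real"]
    by eventually_elim (intro abs_nrm_diff_le vecs_closed Tv x yv less_imp_le)
  have "((\<lambda>d. nrm E (?q d) - nrm E y) \<longlongrightarrow> 0) (at_right 0)"
    by (rule Lim_null_comparison[where g = "\<lambda>d. nrm E (?q d - y)"])
      (use ev y in \<open>simp_all add: has_generator_value_def\<close>)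
  then have "((\<lambda>d. nrm E (?q d)) \<longlongrightarrow> nrm E y) (at_right 0)"
    by (rule LIM_zero_cancel)
  from filterlim_compose[OF this lim0]
  have "(\<lambda>n. nrm E (?q (h / real (Suc n)))) \<longlonglongrightarrow> nrm E y" .
  then have "(\<lambda>n. M * h * nrm E (?q (h / real (Suc n)))) \<longlonglongrightarrow> M * h * nrm E y"
    by (intro tendsto_intros)
  moreover have "nrm E (T h x - x) \<le> M * h * nrm E (?q (h / real (Suc n)))" for n
  proof -
    let ?d = "h / real (Suc n)"
    have d: "0 < ?d"
      using h by simp
    have "nrm E (T (real (Suc n) * ?d) x - x) \<le> real (Suc n) * (M * nrm E (T ?d x - x))"
      by (rule steps[OF d])
    moreover have "real (Suc n) * ?d = h"
      by simp
    moreover have "nrm E (?q ?d) = nrm E (T ?d x - x) / ?d"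
      using d x by (intro nrm_divide vecs_closed Tv less_imp_le)
    ultimately show ?thesis
      using h by (simp del: of_nat_Suc add: field_simps)
  qed
  ultimately show ?thesis
    by (intro LIMSEQ_le_const) auto
qed

text \<open>
  The difference quotients of \<open>x - u\<^sub>n\<close> are bounded, uniformly in the step width, by the limit in \<open>m\<close>
  of those of \<open>u\<^sub>m - u\<^sub>n\<close>, for which the mean value inequality \<open>nrm_orbit_diff_le\<close> gives
  \<open>M \<parallel>v\<^sub>m - v\<^sub>n\<parallel>\<close>. Hence the difference quotient of \<open>x\<close> may be replaced by that of one fixed \<open>u\<^sub>n\<close>.
\<close>

lemma generator_closed:
  assumes T: "C0_semigroup E T" and M: "\<And>t x. 0 \<le> t \<Longrightarrow> x \<in> vecs E \<Longrightarrow> nrm E (T t x) \<le> M * nrm E x"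
    and u: "\<And>n. u n \<in> vecs E" and v: "\<And>n. has_generator_value E T (u n) (v n)"
    and x: "x \<in> vecs E" and ux: "(\<lambda>n. nrm E (u n - x)) \<longlonglongrightarrow> 0"
    and y: "y \<in> vecs E" and vy: "(\<lambda>n. nrm E (v n - y)) \<longlonglongrightarrow> 0"
  shows "has_generator_value E T x y"
proof -
  have Tv: "T t z \<in> vecs E" if "0 \<le> t" "z \<in> vecs E" for t z
    using T that by (auto simp: C0_semigroup_def bounded_op_def)
  have Tadd: "T t (z + w) = T t z + T t w" if "0 \<le> t" "z \<in> vecs E" "w \<in> vecs E" for t z w
    using T that by (auto simp: C0_semigroup_def bounded_op_def)
  have Tdiff: "T t (z - w) = T t z - T t w" if "0 \<le> t" "z \<in> vecs E" "w \<in> vecs E" for t z w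
    using Tadd[of t "z - w" w] that by (simp add: algebra_simps)
  have vv: "v n \<in> vecs E" for n
    using v by (simp add: has_generator_value_def)
  define q where "q z h = smul E (complex_of_real (1 / h)) (T h z - z)" for z h
  have qv: "q z h \<in> vecs E" if "0 < h" "z \<in> vecs E" for z h
    unfolding q_def using that by (intro vecs_closed Tv less_imp_le)
  have q_diff: "q (z - w) h = q z h - q w h" if "0 < h" "z \<in> vecs E" "w \<in> vecs E" for z w h
  proof -
    have "T h (z - w) - (z - w) = (T h z - z) - (T h w - w)"
      using that by (simp add: Tdiff algebra_simps)
    then show ?thesis
      by (simp only: q_def scale_right_diff_distrib)
  qed
  have nq: "nrm E (q z h) = nrm E (T h z - z) / h" if "0 < h" "z \<in> vecs E" for z h
    unfolding q_def using that by (intro nrm_divide vecs_closed Tv less_imp_le)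
  have gdiff: "has_generator_value E T (u m - u n) (v m - v n)" for m n
    unfolding has_generator_value_def q_def[symmetric]
  proof (intro conjI)
    have lim: "((\<lambda>h. nrm E (q (u m) h - v m) + nrm E (q (u n) h - v n)) \<longlongrightarrow> 0 + 0) (at_right 0)"
      using v by (intro tendsto_add) (auto simp: has_generator_value_def q_def)
    show "((\<lambda>h. nrm E (q (u m - u n) h - (v m - v n))) \<longlongrightarrow> 0) (at_right 0)"
    proof (rule Lim_null_comparison)
      show "\<forall>\<^sub>F h in at_right 0. norm (nrm E (q (u m - u n) h - (v m - v n)))
          \<le> nrm E (q (u m) h - v m) + nrm E (q (u n) h - v n)"
        using eventually_at_right_less[of "0::real"]
      proof eventually_elim
        case (elim h)
        have eq: "q (u m - u n) h - (v m - v n) = (q (u m) h - v m) - (q (u n) h - v n)"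
          using elim u by (simp add: q_diff)
        have mem: "q (u m) h - v m \<in> vecs E" "q (u n) h - v n \<in> vecs E"
          using elim u vv qv by blast+
        show ?case
          unfolding eq using nrm_diff_le[OF mem] nrm_nonneg[of "(q (u m) h - v m) - (q (u n) h - v n)"] mem
          by simp
      qed
      show "((\<lambda>h. nrm E (q (u m) h - v m) + nrm E (q (u n) h - v n)) \<longlongrightarrow> 0) (at_right 0)"
        using lim by simp
    qed
  qed (use vv in auto)
  have far: "nrm E (q (x - u n) h) \<le> \<bar>M\<bar> * nrm E (y - v n)" if h: "0 < h" for n h
  proof -
    \<comment> \<open>The last two terms vanish as \<open>m\<close> tends to infinity, for fixed \<open>h\<close>.\<close>
    have le: "nrm E (q (x - u n) h) \<le> \<bar>M\<bar> * nrm E (y - v n)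
        + (\<bar>M\<bar> * nrm E (v m - y) + (\<bar>M\<bar> + 1) / h * nrm E (u m - x))" for m
    proof -
      have "nrm E (T h (x - u m) - (x - u m)) \<le> nrm E (T h (x - u m)) + nrm E (x - u m)"
        using h x u by (intro nrm_diff_le) (auto simp: Tv)
      also have "\<dots> \<le> M * nrm E (x - u m) + nrm E (x - u m)"
        using M[of h "x - u m"] h x u by simp
      also have "\<dots> \<le> \<bar>M\<bar> * nrm E (x - u m) + nrm E (x - u m)"
        using nrm_nonneg[of "x - u m"] x u by (simp add: mult_right_mono)
      finally have 1: "nrm E (q (x - u m) h) \<le> (\<bar>M\<bar> + 1) / h * nrm E (u m - x)"
        using nq[OF h, of "x - u m"] x u h nrm_minus_commute[of x "u m"]
        by (simp add: field_simps)
      have "nrm E (q (u m - u n) h) \<le> M * nrm E (v m - v n)"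
        using nrm_orbit_diff_le[OF T M _ gdiff h, of m n] u h nq[OF h, of "u m - u n"]
        by (simp add: pos_divide_le_eq mult_ac)
      also have "\<dots> \<le> \<bar>M\<bar> * nrm E (v m - v n)"
        using nrm_nonneg[of "v m - v n"] vv by (simp add: mult_right_mono)
      also have "\<dots> \<le> \<bar>M\<bar> * (nrm E (v m - y) + nrm E (y - v n))"
        using nrm_triangle[of "v m - y" "y - v n"] vv y by (intro mult_left_mono) auto
      finally have 2: "nrm E (q (u m - u n) h) \<le> \<bar>M\<bar> * (nrm E (v m - y) + nrm E (y - v n))" .
      have "q (x - u n) h = q (x - u m) h + q (u m - u n) h"
        using h x u by (simp add: q_diff)
      then have "nrm E (q (x - u n) h) \<le> nrm E (q (x - u m) h) + nrm E (q (u m - u n) h)"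
        using nrm_triangle[of "q (x - u m) h" "q (u m - u n) h"] qv[OF h] x u by simp
      then show ?thesis
        using 1 2 by (simp add: algebra_simps)
    qed
    have "(\<lambda>m. \<bar>M\<bar> * nrm E (y - v n) + (\<bar>M\<bar> * nrm E (v m - y) + (\<bar>M\<bar> + 1) / h * nrm E (u m - x)))
        \<longlonglongrightarrow> \<bar>M\<bar> * nrm E (y - v n) + (\<bar>M\<bar> * 0 + (\<bar>M\<bar> + 1) / h * 0)"
      by (intro tendsto_intros ux vy)
    then show ?thesis
      using LIMSEQ_le_const[of _ _ "nrm E (q (x - u n) h)"] le by simp
  qed
  have "((\<lambda>h. nrm E (q x h - y)) \<longlongrightarrow> 0) (at_right 0)"
  proof (rule tendstoI)
    fix e :: real assume e: "0 < e"
    have "(\<lambda>n. (\<bar>M\<bar> + 1) * nrm E (v n - y)) \<longlonglongrightarrow> (\<bar>M\<bar> + 1) * 0"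
      by (intro tendsto_intros vy)
    then have "\<forall>\<^sub>F n in sequentially. (\<bar>M\<bar> + 1) * nrm E (v n - y) < e / 2"
      by (rule order_tendstoD) (use e in simp)
    then obtain n where n: "(\<bar>M\<bar> + 1) * nrm E (v n - y) < e / 2"
      using eventually_happens'[OF sequentially_bot] by blast
    have "((\<lambda>h. nrm E (q (u n) h - v n)) \<longlongrightarrow> 0) (at_right 0)"
      using v[of n] by (simp add: has_generator_value_def q_def)
    then have "\<forall>\<^sub>F h in at_right 0. nrm E (q (u n) h - v n) < e / 2"
      using e by (intro order_tendstoD) auto
    then show "\<forall>\<^sub>F h in at_right 0. dist (nrm E (q x h - y)) 0 < e"
      using eventually_at_right_less[of "0::real"]
    proof eventually_elim
      case (elim h)
      have mem: "q (x - u n) h \<in> vecs E" "q (u n) h - v n \<in> vecs E" "v n - y \<in> vecs E" "q x h - y \<in> vecs E"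
        using elim x y u vv qv by blast+
      have eq: "q x h - y = q (x - u n) h + ((q (u n) h - v n) + (v n - y))"
        using elim u x by (simp add: q_diff)
      have "nrm E (q x h - y) \<le> nrm E (q (x - u n) h) + (nrm E (q (u n) h - v n) + nrm E (v n - y))"
        unfolding eq by (intro order_trans[OF nrm_triangle] add_left_mono nrm_triangle vecs_closed(2) mem)
      also have "\<dots> < e"
        using far[of h n] elim n nrm_minus_commute[of y "v n"] y vv by (simp add: algebra_simps)
      finally show ?case
        using nrm_nonneg mem by (simp add: dist_real_def)
    qed
  qed
  then show ?thesis
    using y by (simp add: has_generator_value_def q_def)
qed

lemma bounded_op_cong:
  assumes "bounded_op E B" "\<And>x. x \<in> vecs E \<Longrightarrow> C x = B x"
  shows "bounded_op E C"
  using assms unfolding bounded_op_def by simp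

lemma bounded_op_compose:
  assumes B: "bounded_op E B" and C: "bounded_op E C"
  shows "bounded_op E (\<lambda>x. B (C x))"
proof -
  obtain b c where b: "\<And>x. x \<in> vecs E \<Longrightarrow> nrm E (B x) \<le> b * nrm E x"
      and c: "\<And>x. x \<in> vecs E \<Longrightarrow> nrm E (C x) \<le> c * nrm E x"
    using B C unfolding bounded_op_def by (elim conjE exE) blast
  have Cv: "C x \<in> vecs E" if "x \<in> vecs E" for x
    using C that by (simp add: bounded_op_def)
  have "nrm E (B (C x)) \<le> \<bar>b\<bar> * c * nrm E x" if x: "x \<in> vecs E" for x
  proof -
    have "nrm E (B (C x)) \<le> b * nrm E (C x)"
      using x by (intro b Cv)
    also have "\<dots> \<le> \<bar>b\<bar> * nrm E (C x)"
      using x by (intro mult_right_mono nrm_nonneg Cv) auto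
    also have "\<dots> \<le> \<bar>b\<bar> * (c * nrm E x)"
      using x by (intro mult_left_mono c) auto
    finally show ?thesis
      by (simp add: mult.assoc)
  qed
  then have "\<exists>K. \<forall>x\<in>vecs E. nrm E (B (C x)) \<le> K * nrm E x"
    by blast
  then show ?thesis
    using B C unfolding bounded_op_def by simp
qed

lemma bounded_op_smul:
  assumes "bounded_op E B"
  shows "bounded_op E (\<lambda>x. B (smul E z x))"
proof -
  obtain C where C: "\<And>x. x \<in> vecs E \<Longrightarrow> nrm E (B x) \<le> C * nrm E x"
    using assms unfolding bounded_op_def by blast
  have "nrm E (B (smul E z x)) \<le> C * cmod z * nrm E x" if "x \<in> vecs E" for x
    using C[of "smul E z x"] that by (simp add: nrm_smul mult.assoc)
  then have "\<exists>C. \<forall>x\<in>vecs E. nrm E (B (smul E z x)) \<le> C * nrm E x"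
    by blast
  moreover have "B (smul E z (smul E c x)) = smul E c (B (smul E z x))" if "x \<in> vecs E" for c x
    using assms that unfolding bounded_op_def by (metis scale_left_commute vecs_closed(4))
  moreover have "B (smul E z (x + y)) = B (smul E z x) + B (smul E z y)"
    if "x \<in> vecs E" "y \<in> vecs E" for x y
    using assms that unfolding bounded_op_def by (metis scale_right_distrib vecs_closed(4))
  ultimately show ?thesis
    using assms unfolding bounded_op_def by blast
qed

lemma bounded_inverseI:
  assumes "bounded_op E B"
    and "\<And>y. y \<in> vecs E \<Longrightarrow> B y \<in> D" "\<And>y. y \<in> vecs E \<Longrightarrow> F (B y) = y"
    and "\<And>x. x \<in> D \<Longrightarrow> F x \<in> vecs E" "\<And>x. x \<in> D \<Longrightarrow> B (F x) = x"
  shows "has_bounded_inverse E D F"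
    and "\<And>y. y \<in> vecs E \<Longrightarrow> the_inv_into D F y = B y"
proof -
  have bij: "bij_betw F D (vecs E)"
    using assms by (intro bij_betw_byWitness[where f' = B]) auto
  show inv: "the_inv_into D F y = B y" if "y \<in> vecs E" for y
    using that assms bij by (intro the_inv_into_f_eq) (auto simp: bij_betw_def)
  show "has_bounded_inverse E D F"
    unfolding has_bounded_inverse_def using bij bounded_op_cong[OF assms(1) inv] by blast
qed

end

section \<open>Sums and Poisson weights\<close>

text \<open>
  Reindexing by the total index \<open>m = j + i\<close>; it governs both the composition of two power series in the
  shift and the action of one such series on weighted sums.
\<close>

lemma sum_triangle_swap:
  fixes h :: "nat \<Rightarrow> nat \<Rightarrow> 'a::comm_monoid_add"
  shows "(\<Sum>j\<le>M. \<Sum>i\<le>M - j. h j i) = (\<Sum>m\<le>M. \<Sum>i\<le>m. h (m - i) i)"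
proof -
  have "(\<Sum>j\<le>M. \<Sum>i\<le>M - j. h j i) = (\<Sum>(j, i)\<in>(SIGMA j:{..M}. {..M - j}). h j i)"
    by (simp add: sum.Sigma)
  also have "\<dots> = (\<Sum>(m, i)\<in>(SIGMA m:{..M}. {..m}). h (m - i) i)"
    by (rule sum.reindex_bij_witness[where i = "\<lambda>(m, i). (m - i, i)" and j = "\<lambda>(j, i). (j + i, i)"]) auto
  finally show ?thesis
    by (simp add: sum.Sigma)
qed

lemma sum_geometric_le:
  fixes x :: real
  assumes "0 \<le> x" "x < 1"
  shows "(\<Sum>j\<le>m. x ^ j) \<le> 1 / (1 - x)"
proof -
  have "(1 - x) * (\<Sum>j\<le>m. x ^ j) = 1 - x ^ Suc m"
    using one_diff_power_eq[of x "Suc m"] by (simp add: lessThan_Suc_atMost)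
  also have "\<dots> \<le> 1"
    using assms by simp
  finally show ?thesis
    using assms by (simp add: field_simps)
qed

lemma sum_exp_le:
  fixes x :: real
  assumes "0 \<le> x"
  shows "(\<Sum>j\<le>m. x ^ j / fact j) \<le> exp x"
proof -
  have "(\<Sum>j\<le>m. x ^ j / fact j) \<le> (\<Sum>j. x ^ j / fact j)"
    using assms summable_exp_generic[of x]
    by (intro sum_le_suminf) (auto simp: divide_inverse mult.commute)
  then show ?thesis
    by (simp add: exp_def divide_inverse mult.commute)
qed

text \<open>
  Chebyshev's inequality for the Poisson distribution, whose variance equals its mean: the indicator
  of the window dominates the parabola \<open>1 - (k - \<mu>)\<^sup>2 / (2 \<mu>)\<close>, and the expectation of that parabola
  is \<open>1/2\<close>.
\<close>

lemma poisson_window_ge_half: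
  fixes \<mu> :: real
  assumes mu: "0 < \<mu>" and n: "\<And>k. \<bar>real k - \<mu>\<bar> \<le> sqrt (2 * \<mu>) \<Longrightarrow> k \<le> n"
  shows "1 / 2 \<le> exp (- \<mu>) * (\<Sum>k\<le>n. \<mu> ^ k / fact k * of_bool (\<bar>real k - \<mu>\<bar> \<le> sqrt (2 * \<mu>)))"
proof -
  define p where "p k = \<mu> ^ k / fact k" for k
  have p_nonneg: "0 \<le> p k" for k
    using mu by (simp add: p_def)
  have p_Suc: "real (Suc k) * p (Suc k) = \<mu> * p k" for k
    by (simp add: p_def fact_Suc del: of_nat_Suc)
  have s0: "p sums exp \<mu>"
    using exp_converges[of \<mu>] by (simp add: p_def[abs_def] divide_inverse mult.commute)
  have "(\<lambda>k. real (Suc k) * p (Suc k)) sums (\<mu> * exp \<mu>)"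
    unfolding p_Suc by (intro sums_mult s0)
  then have s1: "(\<lambda>k. real k * p k) sums (\<mu> * exp \<mu>)"
    using sums_Suc_iff[of "\<lambda>k. real k * p k"] by simp
  have p_Suc2: "real (Suc k) * (real (Suc k) - 1) * p (Suc k) = \<mu> * (real k * p k)" for k
  proof -
    have "real (Suc k) * (real (Suc k) - 1) * p (Suc k) = real k * (real (Suc k) * p (Suc k))"
      by simp
    also have "\<dots> = \<mu> * (real k * p k)"
      unfolding p_Suc by simp
    finally show ?thesis .
  qed
  have "(\<lambda>k. real (Suc k) * (real (Suc k) - 1) * p (Suc k)) sums (\<mu> * (\<mu> * exp \<mu>))"
    unfolding p_Suc2 by (intro sums_mult s1)
  then have s2: "(\<lambda>k. real k * (real k - 1) * p k) sums (\<mu> * (\<mu> * exp \<mu>))"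
    using sums_Suc_iff[of "\<lambda>k. real k * (real k - 1) * p k"] by simp
  let ?g = "\<lambda>k. (1 - (real k - \<mu>)\<^sup>2 / (2 * \<mu>)) * p k"
  have "(\<lambda>k. (1 - \<mu> / 2) * p k + (- (1 - 2 * \<mu>) / (2 * \<mu>)) * (real k * p k)
        + (- 1 / (2 * \<mu>)) * (real k * (real k - 1) * p k))
      sums ((1 - \<mu> / 2) * exp \<mu> + (- (1 - 2 * \<mu>) / (2 * \<mu>)) * (\<mu> * exp \<mu>)
        + (- 1 / (2 * \<mu>)) * (\<mu> * (\<mu> * exp \<mu>)))"
    by (intro sums_add sums_mult s0 s1 s2)
  also have "(\<lambda>k. (1 - \<mu> / 2) * p k + (- (1 - 2 * \<mu>) / (2 * \<mu>)) * (real k * p k)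
        + (- 1 / (2 * \<mu>)) * (real k * (real k - 1) * p k)) = ?g"
    using mu by (auto simp: fun_eq_iff field_simps power2_eq_square)
  also have "(1 - \<mu> / 2) * exp \<mu> + (- (1 - 2 * \<mu>) / (2 * \<mu>)) * (\<mu> * exp \<mu>)
        + (- 1 / (2 * \<mu>)) * (\<mu> * (\<mu> * exp \<mu>)) = exp \<mu> / 2"
    using mu by (simp add: field_simps)
  finally have g: "?g sums (exp \<mu> / 2)" .
  let ?w = "\<lambda>k. p k * of_bool (\<bar>real k - \<mu>\<bar> \<le> sqrt (2 * \<mu>))"
  have "(\<lambda>k. if k \<in> {..n} then ?w k else 0) sums (\<Sum>k\<le>n. ?w k)"
    by (rule sums_If_finite_set) simp
  moreover have le: "?g k \<le> (if k \<in> {..n} then ?w k else 0)" for k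
  proof (cases "\<bar>real k - \<mu>\<bar> \<le> sqrt (2 * \<mu>)")
    case True
    have "?g k \<le> 1 * p k"
      using mu by (intro mult_right_mono p_nonneg) simp
    then show ?thesis
      using True n[OF True] by simp
  next
    case False
    then have "sqrt (2 * \<mu>) ^ 2 \<le> \<bar>real k - \<mu>\<bar> ^ 2"
      using mu by (intro power_mono) auto
    then have "1 - (real k - \<mu>)\<^sup>2 / (2 * \<mu>) \<le> 0"
      using mu by simp
    then have "?g k \<le> 0"
      using p_nonneg by (rule mult_nonpos_nonneg)
    then show ?thesis
      using False by simp
  qed
  ultimately have "exp \<mu> / 2 \<le> (\<Sum>k\<le>n. ?w k)"
    by (intro sums_le[OF le g])
  then have "exp (- \<mu>) * (exp \<mu> / 2) \<le> exp (- \<mu>) * (\<Sum>k\<le>n. ?w k)"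
    by (intro mult_left_mono) auto
  then show ?thesis
    by (simp add: p_def exp_minus)
qed

lemma card_nat_window_le:
  fixes x d :: real
  assumes "0 \<le> d"
  shows "real (card {k::nat. \<bar>real k - x\<bar> \<le> d}) \<le> 2 * d + 1" and "finite {k::nat. \<bar>real k - x\<bar> \<le> d}"
proof -
  have sub: "int ` {k::nat. \<bar>real k - x\<bar> \<le> d} \<subseteq> {\<lceil>x - d\<rceil>..\<lfloor>x + d\<rfloor>}"
    by (auto simp: ceiling_le_iff le_floor_iff)
  then show "finite {k::nat. \<bar>real k - x\<bar> \<le> d}"
    using finite_imageD[of int "{k. \<bar>real k - x\<bar> \<le> d}"] finite_subset inj_on_of_nat by blast
  have "card {k::nat. \<bar>real k - x\<bar> \<le> d} = card (int ` {k::nat. \<bar>real k - x\<bar> \<le> d})"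
    by (simp add: card_image)
  also have "\<dots> \<le> card {\<lceil>x - d\<rceil>..\<lfloor>x + d\<rfloor>}"
    using sub by (intro card_mono) auto
  finally have "real (card {k::nat. \<bar>real k - x\<bar> \<le> d}) \<le> real (nat (\<lfloor>x + d\<rfloor> - \<lceil>x - d\<rceil> + 1))"
    by simp
  also have "\<dots> \<le> 2 * d + 1"
    using assms by linarith
  finally show "real (card {k::nat. \<bar>real k - x\<bar> \<le> d}) \<le> 2 * d + 1" .
qed

section \<open>The space of block vectors\<close>

text \<open>
  The ambient vectors are functions on the real line; the coordinate \<open>k\<close> of block \<open>N\<close> is stored at the
  natural number that encodes the pair \<open>(N, k)\<close>, and the values at all other points will be zero.
\<close>

definition cell :: "nat \<Rightarrow> nat \<Rightarrow> real" where
  "cell N k = real (prod_encode (N, k))"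

definition block :: "(real \<Rightarrow> complex) \<Rightarrow> nat \<Rightarrow> nat \<Rightarrow> complex" where
  "block f N k = f (cell N k)"

definition glue :: "(nat \<Rightarrow> nat \<Rightarrow> complex) \<Rightarrow> real \<Rightarrow> complex" where
  "glue a x = (if x \<in> range real then case prod_decode (nat \<lfloor>x\<rfloor>) of (N, k) \<Rightarrow> a N k else 0)"

lemma block_glue [simp]: "block (glue a) N k = a N k"
  by (simp add: block_def glue_def cell_def)

lemma glue_outside: "x \<notin> range real \<Longrightarrow> glue a x = 0"
  by (simp add: glue_def)

lemma block_eqI:
  assumes "\<And>x. x \<notin> range real \<Longrightarrow> f x = g x" "\<And>N k. block f N k = block g N k"
  shows "f = g"
proof
  fix x
  show "f x = g x"
  proof (cases "x \<in> range real")
    case True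
    then obtain n where n: "x = real n" by auto
    obtain N k where "prod_decode n = (N, k)" by fastforce
    then have "prod_encode (N, k) = n"
      by (metis prod_decode_inverse)
    then show ?thesis
      using assms(2)[of N k] n by (simp add: block_def cell_def)
  qed (use assms in auto)
qed

lemma block_add_fun: "block (f + g) N = (\<lambda>k. block f N k + block g N k)"
  and block_diff_fun: "block (f - g) N = (\<lambda>k. block f N k - block g N k)"
  by (simp_all add: block_def fun_eq_iff)

lemma block_add [simp]: "block (f + g) N k = block f N k + block g N k"
  and block_diff [simp]: "block (f - g) N k = block f N k - block g N k"
  and block_zero [simp]: "block 0 N k = 0"
  by (simp_all add: block_def)

text \<open>
  Block \<open>N\<close> has the frequency \<open>\<nu> = N + 1\<close> and the coordinates \<open>0, \<dots>, K N\<close>. The bounds for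
  the semigroup and the resolvent do not depend on \<open>K\<close>; the lower bound for the decay
  requires \<open>K N\<close> to be so large that a wave packet fits into the block.
\<close>

locale shift_blocks =
  fixes \<alpha> :: real and K :: "nat \<Rightarrow> nat"
  assumes alpha_pos: "0 < \<alpha>"
begin

definition \<nu> :: "nat \<Rightarrow> real" where "\<nu> N = real (Suc N)"

definition \<eta> :: "nat \<Rightarrow> real" where "\<eta> N = \<nu> N powr (- 1 - \<alpha>)"

definition wsum :: "nat \<Rightarrow> (nat \<Rightarrow> complex) \<Rightarrow> real" where
  "wsum N a = \<eta> N * (\<Sum>k\<le>K N. (1 + \<eta> N) ^ k * cmod (a k))"

definition bnorm :: "nat \<Rightarrow> (nat \<Rightarrow> complex) \<Rightarrow> real" where
  "bnorm N a = max (MAX k\<in>{..K N}. cmod (a k)) (wsum N a)"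

definition supported :: "(real \<Rightarrow> complex) \<Rightarrow> bool" where
  "supported f \<longleftrightarrow> (\<forall>x. x \<notin> range real \<longrightarrow> f x = 0) \<and> (\<forall>N k. K N < k \<longrightarrow> block f N k = 0)"

text \<open>
  The direct sum is of \<open>c\<^sub>0\<close> type: the norms of the blocks tend to zero, so that vectors on
  finitely many blocks are dense. Without this condition the semigroup, whose generator has a norm
  of order \<open>\<nu>\<close> on a block, would not be strongly continuous.
\<close>

definition E :: "(real \<Rightarrow> complex) cspace" where
  "E = \<lparr>vecs = {f. supported f \<and> (\<lambda>N. bnorm N (block f N)) \<longlonglongrightarrow> 0},
        smul = (\<lambda>c f x. c * f x),
        nrm = (\<lambda>f. SUP N. bnorm N (block f N))\<rparr>"

lemma nu_ge_1: "1 \<le> \<nu> N" and nu_pos [simp]: "0 < \<nu> N"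
  and nu_nonneg [simp]: "0 \<le> \<nu> N" and nu_nonzero [simp]: "\<nu> N \<noteq> 0"
  by (auto simp: \<nu>_def)

lemma eta_pos [simp]: "0 < \<eta> N" and eta_le_1: "\<eta> N \<le> 1"
proof -
  show "0 < \<eta> N"
    using nu_pos[of N] by (simp add: \<eta>_def)
  have "\<nu> N powr (- 1 - \<alpha>) \<le> \<nu> N powr 0"
    using nu_ge_1[of N] alpha_pos by (intro powr_mono) auto
  then show "\<eta> N \<le> 1"
    using nu_pos[of N] by (simp add: \<eta>_def)
qed

lemma eta_nonneg [simp]: "0 \<le> \<eta> N" and eta_nonzero [simp]: "\<eta> N \<noteq> 0"
  using eta_pos[of N] by linarith+

lemma nu_eta: "\<nu> N * \<eta> N = \<nu> N powr (- \<alpha>)"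
proof -
  have "\<nu> N powr 1 * \<nu> N powr (- 1 - \<alpha>) = \<nu> N powr (1 + (- 1 - \<alpha>))"
    by (rule powr_add[symmetric])
  then show ?thesis
    using nu_pos[of N] by (simp add: \<eta>_def)
qed

lemma bnorm_le_iff: "bnorm N a \<le> e \<longleftrightarrow> (\<forall>k\<le>K N. cmod (a k) \<le> e) \<and> wsum N a \<le> e"
  by (auto simp: bnorm_def)

lemma norm_le_bnorm: "k \<le> K N \<Longrightarrow> cmod (a k) \<le> bnorm N a"
  and wsum_le_bnorm: "wsum N a \<le> bnorm N a"
  using bnorm_le_iff[of N a "bnorm N a"] by auto

lemma wsum_nonneg: "0 \<le> wsum N a"
  by (auto simp: wsum_def intro!: mult_nonneg_nonneg sum_nonneg zero_le_power add_nonneg_nonneg)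

lemma bnorm_nonneg: "0 \<le> bnorm N a"
  using wsum_nonneg wsum_le_bnorm order_trans by blast

lemma bnorm_triangle: "bnorm N (\<lambda>k. a k + b k) \<le> bnorm N a + bnorm N b"
proof -
  have "wsum N (\<lambda>k. a k + b k) \<le> \<eta> N * (\<Sum>k\<le>K N. (1 + \<eta> N) ^ k * cmod (a k) + (1 + \<eta> N) ^ k * cmod (b k))"
    unfolding wsum_def
    by (intro mult_left_mono sum_mono)
      (auto simp: distrib_left[symmetric] add_nonneg_nonneg intro!: mult_left_mono norm_triangle_ineq)
  also have "\<dots> = wsum N a + wsum N b"
    by (simp add: wsum_def sum.distrib algebra_simps)
  also have "\<dots> \<le> bnorm N a + bnorm N b"
    by (intro add_mono wsum_le_bnorm)
  finally have "wsum N (\<lambda>k. a k + b k) \<le> bnorm N a + bnorm N b" .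
  moreover have "cmod (a k + b k) \<le> bnorm N a + bnorm N b" if "k \<le> K N" for k
    using norm_triangle_ineq[of "a k" "b k"] norm_le_bnorm[OF that, of a] norm_le_bnorm[OF that, of b]
    by linarith
  ultimately show ?thesis
    by (simp add: bnorm_le_iff)
qed

lemma wsum_scale: "wsum N (\<lambda>k. c * a k) = cmod c * wsum N a"
  by (simp add: wsum_def norm_mult sum_distrib_left mult_ac)

lemma bnorm_scale: "bnorm N (\<lambda>k. c * a k) = cmod c * bnorm N a"
proof -
  have le: "bnorm N (\<lambda>k. d * b k) \<le> cmod d * bnorm N b" for d b
    using norm_le_bnorm[of _ N b] wsum_le_bnorm[of N b]
    by (auto simp: bnorm_le_iff norm_mult wsum_scale intro!: mult_left_mono)
  show ?thesis
  proof (cases "c = 0")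
    case True
    then show ?thesis
      using le[of 0 a] bnorm_nonneg[of N "\<lambda>k. 0"] by simp
  next
    case False
    then have "bnorm N a = bnorm N (\<lambda>k. inverse c * (c * a k))"
      by (simp add: field_simps)
    also have "\<dots> \<le> cmod (inverse c) * bnorm N (\<lambda>k. c * a k)"
      by (rule le)
    finally have "cmod c * bnorm N a \<le> bnorm N (\<lambda>k. c * a k)"
      using False unfolding norm_inverse by (simp add: field_simps)
    then show ?thesis
      using le[of c a] by simp
  qed
qed

lemma bnorm_cong: "(\<And>k. k \<le> K N \<Longrightarrow> a k = b k) \<Longrightarrow> bnorm N a = bnorm N b"
  by (simp add: bnorm_def wsum_def)

lemma bnorm_zero [simp]: "bnorm N (\<lambda>k. 0) = 0"
  using bnorm_scale[of N 0 "\<lambda>k. 0"] by simp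

lemma bnorm_diff_commute: "bnorm N (\<lambda>k. a k - b k) = bnorm N (\<lambda>k. b k - a k)"
  using bnorm_scale[of N "-1" "\<lambda>k. a k - b k"] by simp

lemma E_simps:
  "f \<in> vecs E \<longleftrightarrow> supported f \<and> (\<lambda>N. bnorm N (block f N)) \<longlonglongrightarrow> 0"
  "smul E c f = (\<lambda>x. c * f x)"
  "nrm E f = (SUP N. bnorm N (block f N))"
  by (simp_all add: E_def)

lemma block_smul [simp]: "block (smul E c f) N k = c * block f N k"
  by (simp add: E_simps block_def)

lemma supported_eqI:
  "supported f \<Longrightarrow> supported g \<Longrightarrow> (\<And>N k. k \<le> K N \<Longrightarrow> block f N k = block g N k) \<Longrightarrow> f = g"
  by (rule block_eqI) (metis supported_def, metis supported_def not_le)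

lemma bnorm_le_nrm:
  assumes "f \<in> vecs E"
  shows "bnorm N (block f N) \<le> nrm E f"
proof -
  have "Bseq (\<lambda>N. bnorm N (block f N))"
    using assms by (auto simp: E_simps intro: convergent_imp_Bseq convergentI)
  then have "bdd_above (range (\<lambda>N. bnorm N (block f N)))"
    unfolding Bseq_eq_bounded by (rule bounded_imp_bdd_above)
  then show ?thesis
    unfolding E_simps by (intro cSUP_upper) auto
qed

lemma nrm_le:
  assumes "\<And>N. bnorm N (block f N) \<le> e"
  shows "nrm E f \<le> e"
  unfolding E_simps using assms by (intro cSUP_least) auto

lemma vecs_add: "f \<in> vecs E \<Longrightarrow> g \<in> vecs E \<Longrightarrow> f + g \<in> vecs E"
proof -
  assume f: "f \<in> vecs E" and g: "g \<in> vecs E"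
  have "(\<lambda>N. bnorm N (block (f + g) N)) \<longlonglongrightarrow> 0"
  proof (rule Lim_null_comparison)
    have "bnorm N (block (f + g) N) \<le> bnorm N (block f N) + bnorm N (block g N)" for N
      using bnorm_triangle[of N "block f N" "block g N"] by (simp add: block_add_fun)
    then show "\<forall>\<^sub>F N in sequentially. norm (bnorm N (block (f + g) N))
        \<le> bnorm N (block f N) + bnorm N (block g N)"
      by (simp add: bnorm_nonneg)
    show "(\<lambda>N. bnorm N (block f N) + bnorm N (block g N)) \<longlonglongrightarrow> 0"
      using tendsto_add[of _ 0 _ _ 0] f g by (auto simp: E_simps)
  qed
  then show ?thesis
    using f g by (auto simp: E_simps supported_def)
qed

lemma block_smul_fun: "block (smul E c f) N = (\<lambda>k. c * block f N k)"
  by auto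

lemma vecs_smul: "f \<in> vecs E \<Longrightarrow> smul E c f \<in> vecs E"
  using tendsto_mult_right_zero[of "\<lambda>N. bnorm N (block f N)" sequentially "cmod c"]
  by (auto simp: E_simps(1) block_smul_fun bnorm_scale supported_def) (auto simp: E_simps)

lemma vecs_zero: "0 \<in> vecs E"
  by (simp add: E_simps supported_def block_def cong: bnorm_cong)

text \<open>
  A norm bound on a block is a conjunction of closed conditions on finitely many coordinates
  (\<open>bnorm_le_iff\<close>), so it passes to coordinatewise limits; as the bounds are uniform in the block,
  the \<open>c\<^sub>0\<close> condition passes to the limit as well.
\<close>

lemma nrm_complete:
  assumes u: "\<And>n. u n \<in> vecs E"
    and Cauchy: "\<And>e. e > 0 \<Longrightarrow> \<exists>N. \<forall>m\<ge>N. \<forall>n\<ge>N. nrm E (u m - u n) < e"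
  shows "\<exists>x\<in>vecs E. (\<lambda>n. nrm E (u n - x)) \<longlonglongrightarrow> 0"
proof -
  have diff: "f - g \<in> vecs E" if "f \<in> vecs E" "g \<in> vecs E" for f g
    using vecs_add[OF that(1) vecs_smul[OF that(2), of "-1"]] by (simp add: E_simps(2) fun_diff_def plus_fun_def)
  have coord: "\<exists>l. (\<lambda>n. block (u n) N k) \<longlonglongrightarrow> l" if "k \<le> K N" for N k
  proof -
    have "Cauchy (\<lambda>n. block (u n) N k)"
    proof (rule metric_CauchyI)
      fix e :: real assume "0 < e"
      then obtain n0 where n0: "\<forall>m\<ge>n0. \<forall>n\<ge>n0. nrm E (u m - u n) < e"
        using Cauchy by blast
      have "dist (block (u m) N k) (block (u n) N k) < e" if "m \<ge> n0" "n \<ge> n0" for m n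
      proof -
        have "dist (block (u m) N k) (block (u n) N k) = cmod (block (u m - u n) N k)"
          by (simp add: dist_norm)
        also have "\<dots> \<le> nrm E (u m - u n)"
          using norm_le_bnorm[OF \<open>k \<le> K N\<close>] bnorm_le_nrm[OF diff[OF u u]] order_trans by blast
        finally show ?thesis
          using n0 that by fastforce
      qed
      then show "\<exists>M. \<forall>m\<ge>M. \<forall>n\<ge>M. dist (block (u m) N k) (block (u n) N k) < e"
        by blast
    qed
    then show ?thesis
      using convergent_eq_Cauchy convergent_def by blast
  qed
  then obtain l where l: "\<And>N k. k \<le> K N \<Longrightarrow> (\<lambda>n. block (u n) N k) \<longlonglongrightarrow> l N k"
    by metis
  define x where "x = glue (\<lambda>N k. if k \<le> K N then l N k else 0)"
  have supp: "supported x"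
    by (auto simp: supported_def x_def glue_outside)
  have close: "\<exists>n0. \<forall>n\<ge>n0. \<forall>N. bnorm N (block (u n - x) N) \<le> e" if e: "0 < e" for e
  proof -
    obtain n0 where n0: "\<forall>m\<ge>n0. \<forall>n\<ge>n0. nrm E (u m - u n) < e"
      using Cauchy e by blast
    have "bnorm N (block (u n - x) N) \<le> e" if n: "n \<ge> n0" for n N
    proof -
      have le: "bnorm N (block (u n - u m) N) \<le> e" if "m \<ge> n0" for m
        using bnorm_le_nrm[OF diff[OF u u], of N n m] n0 that n by fastforce
      have lim: "(\<lambda>m. cmod (block (u n - u m) N k)) \<longlonglongrightarrow> cmod (block (u n - x) N k)" if "k \<le> K N" for k
        using l[OF that] that unfolding block_diff
        by (intro tendsto_intros) (simp add: x_def)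
      have "cmod (block (u n - x) N k) \<le> e" if "k \<le> K N" for k
        using le that norm_le_bnorm[OF that, of "block (u n - u _) N"]
        by (intro LIMSEQ_le_const2[OF lim[OF that]] exI[of _ n0]) (meson order_trans)
      moreover have "wsum N (block (u n - x) N) \<le> e"
      proof (rule LIMSEQ_le_const2)
        show "(\<lambda>m. wsum N (block (u n - u m) N)) \<longlonglongrightarrow> wsum N (block (u n - x) N)"
          unfolding wsum_def by (intro tendsto_mult tendsto_sum tendsto_const lim) simp
        show "\<exists>n0. \<forall>m\<ge>n0. wsum N (block (u n - u m) N) \<le> e"
          using le wsum_le_bnorm order_trans by blast
      qed
      ultimately show ?thesis
        by (simp add: bnorm_le_iff)
    qed
    then show ?thesis by blast
  qed
  have "(\<lambda>N. bnorm N (block x N)) \<longlonglongrightarrow> 0"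
  proof (rule LIMSEQ_I)
    fix e :: real assume e: "0 < e"
    obtain n where n: "\<And>N. bnorm N (block (u n - x) N) \<le> e / 2"
      using close[of "e / 2"] e by auto
    have "(\<lambda>N. bnorm N (block (u n) N)) \<longlonglongrightarrow> 0"
      using u[of n] by (simp add: E_simps)
    then obtain N0 where N0: "\<And>N. N \<ge> N0 \<Longrightarrow> bnorm N (block (u n) N) < e / 2"
      using e LIMSEQ_D[of _ 0 "e / 2"] by (force simp: abs_less_iff)
    have "bnorm N (block x N) < e" if "N \<ge> N0" for N
    proof -
      have "bnorm N (block x N) = bnorm N (\<lambda>k. block (u n) N k + (block x N k - block (u n) N k))"
        by simp
      also have "\<dots> \<le> bnorm N (block (u n) N) + bnorm N (\<lambda>k. block x N k - block (u n) N k)"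
        by (rule bnorm_triangle)
      also have "bnorm N (\<lambda>k. block x N k - block (u n) N k) = bnorm N (block (u n - x) N)"
        by (subst bnorm_diff_commute) (simp add: block_diff_fun)
      finally show ?thesis
        using N0[OF that] n[of N] by simp
    qed
    then show "\<exists>no. \<forall>N\<ge>no. norm (bnorm N (block x N) - 0) < e"
      by (auto simp: bnorm_nonneg)
  qed
  then have x: "x \<in> vecs E"
    using supp by (simp add: E_simps)
  have "(\<lambda>n. nrm E (u n - x)) \<longlonglongrightarrow> 0"
  proof (rule LIMSEQ_I)
    fix e :: real assume e: "0 < e"
    obtain n0 where n0: "\<And>n N. n \<ge> n0 \<Longrightarrow> bnorm N (block (u n - x) N) \<le> e / 2"
      using close[of "e / 2"] e by auto
    have "\<bar>nrm E (u n - x)\<bar> < e" if "n \<ge> n0" for n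
    proof -
      have "nrm E (u n - x) \<le> e / 2"
        using n0[OF that] by (rule nrm_le)
      moreover have "0 \<le> nrm E (u n - x)"
        using bnorm_le_nrm[OF diff[OF u x]] bnorm_nonneg order_trans by blast
      ultimately show ?thesis using e by simp
    qed
    then show "\<exists>no. \<forall>n\<ge>no. norm (nrm E (u n - x) - 0) < e"
      by auto
  qed
  then show ?thesis
    using x by blast
qed

lemma vector_space_E: "vector_space (smul E)"
proof
  show "smul E a (x + y) = smul E a x + smul E a y" for a x y
    by (simp add: E_simps plus_fun_def algebra_simps)
  show "smul E (a + b) x = smul E a x + smul E b x" for a b x
    by (simp add: E_simps plus_fun_def algebra_simps)
  show "smul E a (smul E b x) = smul E (a * b) x" for a b x
    by (simp add: E_simps mult.assoc)
  show "smul E 1 x = x" for x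
    by (simp add: E_simps)
qed

sublocale complex_banach_space E
proof (intro complex_banach_space.intro complex_banach_space_axioms.intro vector_space_E)
  show "module.subspace (smul E) (vecs E)"
    by (rule module.subspaceI[OF module_iff_vector_space[THEN iffD2, OF vector_space_E] vecs_zero vecs_add vecs_smul])
  show "nrm E x = 0 \<longleftrightarrow> x = 0" if x: "x \<in> vecs E" for x
  proof
    assume 0: "nrm E x = 0"
    show "x = 0"
    proof (rule supported_eqI)
      show "supported x" "supported 0"
        using x vecs_zero by (auto simp: E_simps)
      show "block x N k = block 0 N k" if "k \<le> K N" for N k
        using norm_le_bnorm[OF that, of "block x N"] bnorm_le_nrm[OF x, of N] 0
          norm_ge_zero[of "block x N k"] by (simp only: block_zero norm_le_zero_iff[symmetric])
    qed
  next
    assume "x = 0"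
    moreover have "bnorm N (block 0 N) = 0" for N
      by (simp cong: bnorm_cong)
    ultimately show "nrm E x = 0"
      by (simp add: E_simps)
  qed
  show "nrm E (x + y) \<le> nrm E x + nrm E y" if "x \<in> vecs E" "y \<in> vecs E" for x y
  proof (rule nrm_le)
    fix N
    have "bnorm N (block (x + y) N) \<le> bnorm N (block x N) + bnorm N (block y N)"
      using bnorm_triangle[of N "block x N" "block y N"] by (simp cong: bnorm_cong)
    also have "\<dots> \<le> nrm E x + nrm E y"
      by (intro add_mono bnorm_le_nrm that)
    finally show "bnorm N (block (x + y) N) \<le> nrm E x + nrm E y" .
  qed
  have smul_le: "nrm E (smul E c x) \<le> cmod c * nrm E x" if "x \<in> vecs E" for x c
    using bnorm_le_nrm[OF that] by (intro nrm_le) (auto simp: block_smul_fun bnorm_scale intro: mult_left_mono)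
  show "nrm E (smul E c x) = cmod c * nrm E x" if x: "x \<in> vecs E" for x c
  proof (cases "c = 0")
    case True
    then show ?thesis
      using smul_le[OF x, of 0] bnorm_le_nrm[OF vecs_smul[OF x, of 0], of 0]
        bnorm_nonneg[of 0 "block (smul E 0 x) 0"] by auto
  next
    case False
    have "nrm E x = nrm E (smul E (inverse c) (smul E c x))"
      using False by (simp add: E_simps(2) field_simps)
    also have "\<dots> \<le> cmod (inverse c) * nrm E (smul E c x)"
      by (intro smul_le vecs_smul x)
    finally have "cmod c * nrm E x \<le> nrm E (smul E c x)"
      using False unfolding norm_inverse by (simp add: field_simps)
    then show ?thesis
      using smul_le[OF x, of c] by simp
  qed
qed (rule nrm_complete)

section \<open>Operators acting as power series in the shift\<close>

text \<open>
  On block \<open>N\<close> this is the power series \<open>c N\<close>, the symbol, evaluated at the left shift \<open>U\<close>. Since \<open>U\<close> is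
  nilpotent on a block, the sum is finite for every formal power series.
\<close>

definition act :: "(nat \<Rightarrow> complex fps) \<Rightarrow> (real \<Rightarrow> complex) \<Rightarrow> real \<Rightarrow> complex" where
  "act c f = glue (\<lambda>N k. \<Sum>j\<le>K N - k. fps_nth (c N) j * block f N (k + j))"

lemma block_act: "block (act c f) N k = (\<Sum>j\<le>K N - k. fps_nth (c N) j * block f N (k + j))"
  by (simp add: act_def)

lemma act_eqI:
  assumes "\<And>N k. block (act c f) N k = block (act d g) N k"
  shows "act c f = act d g"
  using assms by (intro block_eqI) (auto simp: act_def glue_outside)

lemma act_supported [simp]: "supported f \<Longrightarrow> supported (act c f)"
  by (auto simp: supported_def block_act) (simp add: act_def glue_outside)

lemma act_add_right: "act c (f + g) = act c f + act c g"
  by (rule block_eqI) (auto simp: block_act sum.distrib algebra_simps, simp add: act_def glue_outside)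

lemma act_diff_left: "act (\<lambda>N. c N - d N) f = act c f - act d f"
  by (rule block_eqI) (auto simp: block_act sum_subtractf algebra_simps, simp add: act_def glue_outside)

lemma act_smul_right: "act c (smul E z f) = smul E z (act c f)"
  by (rule block_eqI)
    (auto simp: block_act sum_distrib_left mult_ac, simp add: act_def glue_outside E_simps)

lemma act_smul_left: "act (\<lambda>N. fps_const z * c N) f = smul E z (act c f)"
  by (rule block_eqI)
    (auto simp: block_act sum_distrib_left mult_ac, simp add: act_def glue_outside E_simps)

lemma act_one [simp]: "supported f \<Longrightarrow> act (\<lambda>N. 1) f = f"
  by (rule supported_eqI) (auto simp: block_act if_distrib[where f = "\<lambda>x. x * _"] sum.delta' cong: if_cong)

lemma act_act: "act c (act d f) = act (\<lambda>N. c N * d N) f"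
proof (rule act_eqI)
  fix N k
  have "block (act c (act d f)) N k
      = (\<Sum>j\<le>K N - k. \<Sum>i\<le>(K N - k) - j. (c N $ j * d N $ i) * block f N (k + (j + i)))"
    by (simp add: block_act sum_distrib_left mult.assoc add.assoc diff_diff_eq)
  also have "\<dots> = (\<Sum>m\<le>K N - k. \<Sum>i\<le>m. (c N $ (m - i) * d N $ i) * block f N (k + m))"
    by (subst sum_triangle_swap) simp
  also have "\<dots> = (\<Sum>m\<le>K N - k. (d N * c N) $ m * block f N (k + m))"
    unfolding fps_mult_nth sum_distrib_right atLeast0AtMost by (simp add: mult_ac)
  finally show "block (act c (act d f)) N k = block (act (\<lambda>N. c N * d N) f) N k"
    by (simp add: block_act mult.commute)
qed

lemma act_coord_le_l1:
  assumes "(\<Sum>j\<le>K N. cmod (c N $ j)) \<le> S" "k \<le> K N"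
  shows "cmod (block (act c f) N k) \<le> S * bnorm N (block f N)"
proof -
  have "cmod (block (act c f) N k) \<le> (\<Sum>j\<le>K N - k. cmod (c N $ j) * bnorm N (block f N))"
    unfolding block_act
    by (intro sum_norm_le) (use assms(2) in \<open>auto simp: norm_mult intro!: mult_left_mono norm_le_bnorm\<close>)
  also have "\<dots> = (\<Sum>j\<le>K N - k. cmod (c N $ j)) * bnorm N (block f N)"
    by (simp add: sum_distrib_right)
  also have "\<dots> \<le> (\<Sum>j\<le>K N. cmod (c N $ j)) * bnorm N (block f N)"
    by (intro mult_right_mono sum_mono2 bnorm_nonneg) auto
  also have "\<dots> \<le> S * bnorm N (block f N)"
    using assms by (intro mult_right_mono bnorm_nonneg)
  finally show ?thesis .
qed

text \<open>
  Here the two norms of a block interact: the supremum norm of the image is controlled by the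
  coefficients' supremum only, if one pays with the weighted sum of the argument.
\<close>

lemma act_coord_le_wsum:
  assumes c: "\<And>j. cmod (c N $ j) \<le> b" and k: "k \<le> K N"
  shows "cmod (block (act c f) N k) \<le> b / \<eta> N * wsum N (block f N)"
proof -
  have b: "0 \<le> b"
    using c[of 0] norm_ge_zero order_trans by blast
  have "cmod (block (act c f) N k) \<le> (\<Sum>j\<le>K N - k. b * cmod (block f N (k + j)))"
    unfolding block_act by (intro sum_norm_le) (auto simp: norm_mult intro!: mult_right_mono c)
  also have "\<dots> = b * (\<Sum>m\<in>(+) k ` {..K N - k}. cmod (block f N m))"
    by (simp add: sum_distrib_left sum.reindex)
  also have "\<dots> \<le> b * (\<Sum>m\<le>K N. cmod (block f N m))"
    using k b by (intro mult_left_mono sum_mono2) auto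
  also have "\<dots> \<le> b * (\<Sum>m\<le>K N. (1 + \<eta> N) ^ m * cmod (block f N m))"
    using b by (intro mult_left_mono sum_mono) (auto intro!: mult_left_mono simp: mult_ge1_I mult_le_cancel_right1)
  also have "\<dots> = b / \<eta> N * wsum N (block f N)"
    using eta_pos[of N] by (simp add: wsum_def)
  finally show ?thesis .
qed

text \<open>
  For the weighted sum each application of the shift gains a factor \<open>1 / (1 + \<eta>)\<close>.
\<close>

lemma wsum_act_le:
  assumes S: "\<And>m. m \<le> K N \<Longrightarrow> (\<Sum>j\<le>m. cmod (c N $ j) / (1 + \<eta> N) ^ j) \<le> S"
  shows "wsum N (block (act c f) N) \<le> S * wsum N (block f N)"
proof -
  let ?r = "1 + \<eta> N"
  have r: "0 < ?r"
    using eta_pos[of N] by linarith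
  have "(\<Sum>k\<le>K N. ?r ^ k * cmod (block (act c f) N k))
      \<le> (\<Sum>k\<le>K N. \<Sum>j\<le>K N - k. ?r ^ k * (cmod (c N $ j) * cmod (block f N (k + j))))"
    unfolding block_act sum_distrib_left[symmetric] using r
    by (intro sum_mono mult_left_mono sum_norm_le) (auto simp: norm_mult)
  also have "\<dots> = (\<Sum>m\<le>K N. \<Sum>j\<le>m. ?r ^ (m - j) * (cmod (c N $ j) * cmod (block f N m)))"
    by (subst sum_triangle_swap) simp
  also have "\<dots> = (\<Sum>m\<le>K N. (\<Sum>j\<le>m. cmod (c N $ j) / ?r ^ j) * (?r ^ m * cmod (block f N m)))"
    unfolding sum_distrib_right using r
    by (intro sum.cong refl) (auto simp: power_diff field_simps)
  also have "\<dots> \<le> (\<Sum>m\<le>K N. S * (?r ^ m * cmod (block f N m)))"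
    using r by (intro sum_mono mult_right_mono S) auto
  finally have "\<eta> N * (\<Sum>k\<le>K N. ?r ^ k * cmod (block (act c f) N k))
      \<le> \<eta> N * (\<Sum>m\<le>K N. S * (?r ^ m * cmod (block f N m)))"
    by (intro mult_left_mono) auto
  then show ?thesis
    by (simp add: wsum_def sum_distrib_left mult_ac)
qed

lemma bnorm_act_le_l1:
  assumes S: "(\<Sum>j\<le>K N. cmod (c N $ j)) \<le> S"
  shows "bnorm N (block (act c f) N) \<le> S * bnorm N (block f N)"
proof -
  have S0: "0 \<le> S"
    using S order_trans[OF sum_nonneg] by (metis norm_ge_zero)
  have "(\<Sum>j\<le>m. cmod (c N $ j) / (1 + \<eta> N) ^ j) \<le> S" if m: "m \<le> K N" for m
  proof -
    have "(\<Sum>j\<le>m. cmod (c N $ j) / (1 + \<eta> N) ^ j) \<le> (\<Sum>j\<le>m. cmod (c N $ j) / 1)"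
      by (intro sum_mono divide_left_mono) (auto simp: add_pos_nonneg)
    also have "\<dots> \<le> (\<Sum>j\<le>K N. cmod (c N $ j))"
      using m by (auto intro!: sum_mono2)
    finally show ?thesis
      using S by simp
  qed
  then have "wsum N (block (act c f) N) \<le> S * wsum N (block f N)"
    by (rule wsum_act_le)
  also have "\<dots> \<le> S * bnorm N (block f N)"
    by (intro mult_left_mono wsum_le_bnorm S0)
  finally show ?thesis
    using act_coord_le_l1[of c N S, OF S] by (simp add: bnorm_le_iff)
qed

lemma vecs_supported: "f \<in> vecs E \<Longrightarrow> supported f"
  by (simp add: E_simps)

lemma act_bounded:
  assumes "\<And>N f. bnorm N (block (act c f) N) \<le> C * bnorm N (block f N)"
  shows "f \<in> vecs E \<Longrightarrow> act c f \<in> vecs E"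
    and "f \<in> vecs E \<Longrightarrow> nrm E (act c f) \<le> \<bar>C\<bar> * nrm E f"
    and "bounded_op E (act c)"
proof -
  have le: "bnorm N (block (act c f) N) \<le> \<bar>C\<bar> * bnorm N (block f N)" for N f
    using assms[of N f] mult_right_mono[OF abs_ge_self[of C] bnorm_nonneg[of N "block f N"]]
    by linarith
  show vecs: "act c f \<in> vecs E" if f: "f \<in> vecs E" for f
  proof -
    have "(\<lambda>N. bnorm N (block (act c f) N)) \<longlonglongrightarrow> 0"
    proof (rule Lim_null_comparison)
      show "\<forall>\<^sub>F N in sequentially. norm (bnorm N (block (act c f) N)) \<le> \<bar>C\<bar> * bnorm N (block f N)"
        using le by (simp add: bnorm_nonneg)
      show "(\<lambda>N. \<bar>C\<bar> * bnorm N (block f N)) \<longlonglongrightarrow> 0"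
        using f by (intro tendsto_mult_right_zero) (simp add: E_simps)
    qed
    then show ?thesis
      using f by (simp add: E_simps)
  qed
  show nrm: "nrm E (act c f) \<le> \<bar>C\<bar> * nrm E f" if f: "f \<in> vecs E" for f
    using le bnorm_le_nrm[OF f] by (intro nrm_le) (meson abs_ge_zero mult_left_mono order_trans)
  show "bounded_op E (act c)"
    unfolding bounded_op_def using vecs nrm by (auto simp: act_add_right act_smul_right)
qed

text \<open>
  The symbol of the projection onto the first blocks.
\<close>

definition trunc :: "nat \<Rightarrow> nat \<Rightarrow> complex fps" where
  "trunc M N = (if N \<le> M then 1 else 0)"

text \<open>
  On finitely many blocks an operator is controlled by finitely many coefficients. Convergence
  of every single coefficient therefore implies convergence on the range of a truncation, and this
  gives both the strong continuity of the semigroup and the values of its generator on a dense set.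
\<close>

lemma bnorm_act_trunc_le:
  "bnorm N (block (act (\<lambda>N. c N * trunc M N) f) N)
    \<le> (\<Sum>N\<le>M. \<Sum>j\<le>K N. cmod (c N $ j)) * bnorm N (block f N)"
proof (rule bnorm_act_le_l1)
  show "(\<Sum>j\<le>K N. cmod ((c N * trunc M N) $ j)) \<le> (\<Sum>N\<le>M. \<Sum>j\<le>K N. cmod (c N $ j))"
  proof (cases "N \<le> M")
    case True
    then show ?thesis
      using member_le_sum[of N "{..M}" "\<lambda>N. \<Sum>j\<le>K N. cmod (c N $ j)"]
      by (simp add: trunc_def sum_nonneg)
  qed (simp add: trunc_def sum_nonneg)
qed

lemmas act_trunc_bounded = act_bounded[OF bnorm_act_trunc_le]

lemma trunc_vecs: "f \<in> vecs E \<Longrightarrow> act (trunc M) f \<in> vecs E"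
  using act_trunc_bounded(1)[of f "\<lambda>N. 1"] by simp

lemma nrm_act_trunc_le:
  assumes "f \<in> vecs E"
  shows "nrm E (act (\<lambda>N. c N * trunc M N) f) \<le> (\<Sum>N\<le>M. \<Sum>j\<le>K N. cmod (c N $ j)) * nrm E f"
  using act_trunc_bounded(2)[OF assms, of c M] by (simp add: sum_nonneg)

lemma trunc_tendsto:
  assumes f: "f \<in> vecs E"
  shows "(\<lambda>M. nrm E (act (trunc M) f - f)) \<longlonglongrightarrow> 0"
proof (rule LIMSEQ_I)
  fix e :: real assume e: "0 < e"
  have "(\<lambda>N. bnorm N (block f N)) \<longlonglongrightarrow> 0"
    using f by (simp add: E_simps)
  then obtain N0 where N0: "\<And>N. N \<ge> N0 \<Longrightarrow> bnorm N (block f N) < e / 2"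
    using e LIMSEQ_D[of _ 0 "e / 2"] by (force simp: abs_less_iff)
  have "nrm E (act (trunc M) f - f) \<le> e / 2" if M: "N0 \<le> M" for M
  proof (rule nrm_le)
    fix N
    let ?d = "act (\<lambda>N. trunc M N - 1) f"
    have eq: "act (trunc M) f - f = ?d"
      using f by (simp add: act_diff_left vecs_supported)
    show "bnorm N (block (act (trunc M) f - f) N) \<le> e / 2"
    proof (cases "N \<le> M")
      case True
      then have "bnorm N (block ?d N) \<le> 0 * bnorm N (block f N)"
        by (intro bnorm_act_le_l1) (simp add: trunc_def)
      then show ?thesis
        using e eq by simp
    next
      case False
      have "(\<Sum>j\<le>K N. cmod ((trunc M N - 1) $ j)) = (\<Sum>j\<le>K N. if j = 0 then 1 else 0)"
        using False by (intro sum.cong) (auto simp: trunc_def)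
      then have "bnorm N (block ?d N) \<le> 1 * bnorm N (block f N)"
        by (intro bnorm_act_le_l1) simp
      then show ?thesis
        using N0[of N] M False eq by simp
    qed
  qed
  then show "\<exists>no. \<forall>M\<ge>no. norm (nrm E (act (trunc M) f - f) - 0) < e"
    using e f nrm_nonneg by (intro exI[of _ N0]) (fastforce simp: trunc_vecs)
qed

section \<open>The semigroup\<close>

text \<open>
  The exponential of \<open>t (\<i> \<nu> - \<nu> + \<nu> U)\<close>, split into its scalar part and its part in \<open>U\<close>.
\<close>

definition T_sym :: "real \<Rightarrow> nat \<Rightarrow> complex fps" where
  "T_sym t N = fps_const (exp ((\<i> - 1) * of_real (\<nu> N * t))) * fps_exp (of_real (\<nu> N * t))"

definition A_sym :: "nat \<Rightarrow> complex fps" where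
  "A_sym N = fps_const ((\<i> - 1) * of_real (\<nu> N)) + fps_const (of_real (\<nu> N)) * fps_X"

abbreviation T :: "real \<Rightarrow> (real \<Rightarrow> complex) \<Rightarrow> real \<Rightarrow> complex" where
  "T t \<equiv> act (T_sym t)"

lemma T_sym_nth: "T_sym t N $ j = exp ((\<i> - 1) * of_real (\<nu> N * t)) * (of_real (\<nu> N * t) ^ j / fact j)"
  by (simp add: T_sym_def)

lemma norm_T_sym_nth: "0 \<le> t \<Longrightarrow> cmod (T_sym t N $ j) = exp (- (\<nu> N * t)) * ((\<nu> N * t) ^ j / fact j)"
  by (simp add: T_sym_nth norm_mult norm_divide norm_power abs_mult del: of_real_mult)

lemma T_sym_0: "T_sym 0 = (\<lambda>N. 1)"
  by (simp add: T_sym_def fun_eq_iff)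

lemma T_sym_add: "T_sym (s + t) N = T_sym s N * T_sym t N"
proof -
  have "fps_const (exp ((\<i> - 1) * complex_of_real (\<nu> N * (s + t))))
      = fps_const (exp ((\<i> - 1) * of_real (\<nu> N * s))) * fps_const (exp ((\<i> - 1) * of_real (\<nu> N * t)))"
    by (simp add: exp_add[symmetric] algebra_simps)
  moreover have "fps_exp (complex_of_real (\<nu> N * (s + t)))
      = fps_exp (of_real (\<nu> N * s)) * fps_exp (of_real (\<nu> N * t))"
    by (simp add: fps_exp_add_mult[symmetric] algebra_simps)
  ultimately show ?thesis
    by (simp add: T_sym_def mult_ac)
qed

text \<open>
  Up to a rotation the coefficients are the weights of a Poisson distribution, so their absolute
  values have sum at most 1.
\<close>

lemma bnorm_T_le:
  assumes "0 \<le> t"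
  shows "bnorm N (block (T t f) N) \<le> 1 * bnorm N (block f N)"
proof (rule bnorm_act_le_l1)
  have "(\<Sum>j\<le>K N. cmod (T_sym t N $ j)) = exp (- (\<nu> N * t)) * (\<Sum>j\<le>K N. (\<nu> N * t) ^ j / fact j)"
    using assms by (simp add: norm_T_sym_nth sum_distrib_left)
  also have "\<dots> \<le> exp (- (\<nu> N * t)) * exp (\<nu> N * t)"
    using assms by (intro mult_left_mono sum_exp_le) auto
  also have "\<dots> = 1"
    by (simp add: exp_minus)
  finally show "(\<Sum>j\<le>K N. cmod (T_sym t N $ j)) \<le> 1" .
qed

lemma nrm_T_le: "0 \<le> t \<Longrightarrow> f \<in> vecs E \<Longrightarrow> nrm E (T t f) \<le> 1 * nrm E f"
  using act_bounded(2)[OF bnorm_T_le] by simp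

lemma T_vecs: "0 \<le> t \<Longrightarrow> f \<in> vecs E \<Longrightarrow> T t f \<in> vecs E"
  by (rule act_bounded(1)[OF bnorm_T_le])

lemma T_sym_tendsto: "((\<lambda>h. cmod ((T_sym h N - 1) $ j)) \<longlongrightarrow> 0) (at_right 0)"
proof -
  have "((\<lambda>h. T_sym h N $ j - 1 $ j) \<longlongrightarrow> T_sym 0 N $ j - 1 $ j) (at_right 0)"
    unfolding T_sym_nth by (intro tendsto_intros) auto
  then show ?thesis
    by (intro tendsto_norm_zero) (simp add: T_sym_0)
qed

lemma T_sym_deriv:
  "((\<lambda>h. (fps_const (of_real (1 / h)) * (T_sym h N - 1) - A_sym N) $ j) \<longlongrightarrow> 0) (at_right 0)"
proof -
  let ?a = "(\<i> - 1) * complex_of_real (\<nu> N)"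
  have "((\<lambda>h. of_real (1 / h) * ((T_sym h N - 1) $ j)) \<longlongrightarrow> A_sym N $ j) (at_right 0)"
  proof (cases j)
    case 0
    have "((\<lambda>z. exp (z * ?a)) has_field_derivative ?a) (at 0)"
      by (auto intro!: derivative_eq_intros)
    from DERIV_D[OF this] have "((\<lambda>z. (exp (z * ?a) - 1) / z) \<longlongrightarrow> ?a) (at 0)"
      by simp
    moreover have "filterlim complex_of_real (at 0) (at_right 0)"
      unfolding filterlim_at using eventually_at_right_less[of "0::real"]
      by (auto elim!: eventually_mono intro!: tendsto_eq_intros)
    ultimately have "((\<lambda>h. (exp (of_real h * ?a) - 1) / of_real h) \<longlongrightarrow> ?a) (at_right 0)"
      by (rule filterlim_compose)
    then show ?thesis
      using 0 by (simp add: T_sym_nth A_sym_def mult_ac)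
  next
    case (Suc i)
    have "((\<lambda>h. exp (?a * of_real h) * (of_real (\<nu> N) ^ j / fact j) * of_real h ^ i)
        \<longlongrightarrow> exp (?a * of_real 0) * (of_real (\<nu> N) ^ j / fact j) * of_real 0 ^ i) (at_right 0)"
      by (intro tendsto_intros)
    also have "exp (?a * of_real 0) * (of_real (\<nu> N) ^ j / fact j) * of_real 0 ^ i = A_sym N $ j"
      using Suc by (cases i) (simp_all add: A_sym_def)
    finally show ?thesis
    proof (rule Lim_transform_eventually)
      show "\<forall>\<^sub>F h in at_right 0. exp (?a * of_real h) * (of_real (\<nu> N) ^ j / fact j) * of_real h ^ i
          = of_real (1 / h) * ((T_sym h N - 1) $ j)"
        using eventually_at_right_less[of "0::real"]
        by eventually_elim (simp add: Suc T_sym_nth power_mult_distrib field_simps del: fact_Suc)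
    qed
  qed
  then show ?thesis
    by (simp add: LIM_zero_iff)
qed

lemma C0_semigroup_T: "C0_semigroup E T"
  unfolding C0_semigroup_def
proof (intro conjI allI impI ballI)
  show "bounded_op E (T t)" if "0 \<le> t" for t
    by (rule act_bounded(3)[OF bnorm_T_le[OF that]])
  show "T 0 f = f" if "f \<in> vecs E" for f
    using that by (simp add: T_sym_0 vecs_supported)
  show "T (s + t) f = T s (T t f)" for s t f
    unfolding act_act T_sym_add[abs_def] ..
  show "((\<lambda>h. nrm E (T h f - f)) \<longlongrightarrow> 0) (at_right 0)" if f: "f \<in> vecs E" for f
  proof (rule tendstoI)
    fix e :: real assume e: "0 < e"
    have "\<forall>\<^sub>F M in sequentially. nrm E (act (trunc M) f - f) < e / 3"
      using trunc_tendsto[OF f] by (rule order_tendstoD) (use e in simp)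
    then obtain M where M: "nrm E (act (trunc M) f - f) < e / 3"
      using eventually_happens'[OF sequentially_bot] by blast
    let ?g = "act (trunc M) f"
    let ?S = "\<lambda>h. \<Sum>N\<le>M. \<Sum>j\<le>K N. cmod ((T_sym h N - 1) $ j)"
    have g: "?g \<in> vecs E"
      using f by (rule trunc_vecs)
    have "((\<lambda>h. ?S h * nrm E f) \<longlongrightarrow> (\<Sum>N\<le>M. \<Sum>j\<le>K N. 0) * nrm E f) (at_right 0)"
      by (intro tendsto_intros T_sym_tendsto)
    then have "\<forall>\<^sub>F h in at_right 0. ?S h * nrm E f < e / 3"
      by (rule order_tendstoD) (use e in simp)
    then show "\<forall>\<^sub>F h in at_right 0. dist (nrm E (T h f - f)) 0 < e"
      using eventually_at_right_less[of "0::real"]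
    proof eventually_elim
      case (elim h)
      have Tv: "T h f \<in> vecs E" "T h ?g \<in> vecs E" "T h (f - ?g) \<in> vecs E"
        using elim f g by (auto intro!: T_vecs)
      have "T h f = T h (f - ?g) + T h ?g"
        using act_add_right[of "T_sym h" "f - ?g" ?g] by simp
      then have eq: "T h f - f = T h (f - ?g) + ((T h ?g - ?g) + (?g - f))"
        by simp
      have "nrm E (T h f - f) \<le> nrm E (T h (f - ?g)) + (nrm E (T h ?g - ?g) + nrm E (?g - f))"
        unfolding eq by (intro order_trans[OF nrm_triangle] add_left_mono nrm_triangle vecs_closed Tv f g)
      moreover have "nrm E (T h (f - ?g)) \<le> nrm E (?g - f)"
        using nrm_T_le[of h "f - ?g"] elim f g nrm_minus_commute[of f ?g] by simp
      moreover have "nrm E (T h ?g - ?g) \<le> ?S h * nrm E f"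
      proof -
        have "T h ?g - ?g = act (\<lambda>N. (T_sym h N - 1) * trunc M N) f"
          by (simp add: act_act act_diff_left[symmetric] algebra_simps)
        then show ?thesis
          using nrm_act_trunc_le[OF f, of "\<lambda>N. T_sym h N - 1" M] by simp
      qed
      moreover have "0 \<le> nrm E (T h f - f)"
        using Tv f by (intro nrm_nonneg) auto
      ultimately show ?case
        using M elim by (simp add: dist_real_def)
    qed
  qed
qed

lemma bounded_C0_semigroup_T: "bounded_C0_semigroup E T"
  unfolding bounded_C0_semigroup_def
  using C0_semigroup_T nrm_T_le by (auto intro!: bdd_aboveI2[of _ _ 1] op_norm_le)

section \<open>The generator\<close>

lemma generator_value_trunc:
  assumes f: "f \<in> vecs E"
  shows "has_generator_value E T (act (trunc M) f) (act (\<lambda>N. A_sym N * trunc M N) f)"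
  unfolding has_generator_value_def
proof
  show "act (\<lambda>N. A_sym N * trunc M N) f \<in> vecs E"
    using f by (rule act_trunc_bounded(1))
  let ?c = "\<lambda>h N. fps_const (complex_of_real (1 / h)) * (T_sym h N - 1) - A_sym N"
  let ?q = "\<lambda>h. smul E (complex_of_real (1 / h)) (T h (act (trunc M) f) - act (trunc M) f)"
  have eq: "?q h - act (\<lambda>N. A_sym N * trunc M N) f = act (\<lambda>N. ?c h N * trunc M N) f" for h
    by (simp only: act_smul_left[symmetric] act_act act_diff_left[symmetric] ring_distribs mult.assoc
        left_diff_distrib right_diff_distrib mult_1_left)
  show "((\<lambda>h. nrm E (?q h - act (\<lambda>N. A_sym N * trunc M N) f)) \<longlongrightarrow> 0) (at_right 0)"
    unfolding eq
  proof (rule Lim_null_comparison)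
    show "\<forall>\<^sub>F h in at_right 0. norm (nrm E (act (\<lambda>N. ?c h N * trunc M N) f))
        \<le> (\<Sum>N\<le>M. \<Sum>j\<le>K N. cmod (?c h N $ j)) * nrm E f"
      unfolding real_norm_def abs_of_nonneg[OF nrm_nonneg[OF act_trunc_bounded(1)[OF f]]]
      by (intro always_eventually allI nrm_act_trunc_le f)
    have "((\<lambda>h. (\<Sum>N\<le>M. \<Sum>j\<le>K N. cmod (?c h N $ j)) * nrm E f)
        \<longlongrightarrow> (\<Sum>N\<le>M. \<Sum>j\<le>K N. cmod 0) * nrm E f) (at_right 0)"
      by (intro tendsto_intros T_sym_deriv)
    then show "((\<lambda>h. (\<Sum>N\<le>M. \<Sum>j\<le>K N. cmod (?c h N $ j)) * nrm E f) \<longlongrightarrow> 0) (at_right 0)"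
      by simp
  qed
qed

text \<open>
  Coordinates are continuous functionals, so any generator value can be computed coordinatewise.
\<close>

lemma generator_value_imp_act:
  assumes x: "x \<in> vecs E" and y: "has_generator_value E T x y"
  shows "y = act A_sym x"
proof (rule supported_eqI)
  let ?c = "\<lambda>h N. fps_const (complex_of_real (1 / h)) * (T_sym h N - 1) - A_sym N"
  let ?q = "\<lambda>h. smul E (complex_of_real (1 / h)) (T h x - x)"
  have yv: "y \<in> vecs E"
    using y by (simp add: has_generator_value_def)
  show "supported y" "supported (act A_sym x)"
    using x yv by (auto simp: vecs_supported)
  fix N k assume k: "k \<le> K N"
  have "smul E z (T h x - x) = act (\<lambda>N. fps_const z * (T_sym h N - 1) - A_sym N) x + act A_sym x" for z h
    using vecs_supported[OF x] by (simp add: act_smul_left act_diff_left)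
  then have q: "?q h = act (?c h) x + act A_sym x" for h .
  have "((\<lambda>h. block (act (?c h) x) N k) \<longlongrightarrow> (\<Sum>j\<le>K N - k. 0 * block x N (k + j))) (at_right 0)"
    unfolding block_act by (intro tendsto_intros T_sym_deriv)
  then have 1: "((\<lambda>h. block (act (?c h) x) N k) \<longlongrightarrow> 0) (at_right 0)"
    by simp
  have 2: "((\<lambda>h. block (?q h - y) N k) \<longlongrightarrow> 0) (at_right 0)"
  proof (rule Lim_null_comparison)
    show "((\<lambda>h. nrm E (?q h - y)) \<longlongrightarrow> 0) (at_right 0)"
      using y by (simp add: has_generator_value_def)
    show "\<forall>\<^sub>F h in at_right 0. norm (block (?q h - y) N k) \<le> nrm E (?q h - y)"
      using eventually_at_right_less[of "0::real"]
    proof eventually_elim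
      case (elim h)
      have "?q h - y \<in> vecs E"
        using elim x yv by (intro vecs_closed T_vecs) auto
      then show ?case
        using norm_le_bnorm[OF k] bnorm_le_nrm order_trans by blast
    qed
  qed
  have "((\<lambda>h. block (act (?c h) x) N k - block (?q h - y) N k) \<longlongrightarrow> 0 - 0) (at_right 0)"
    by (intro tendsto_diff 1 2)
  moreover have "block (act (?c h) x) N k - block (?q h - y) N k = block y N k - block (act A_sym x) N k" for h
    unfolding q by (simp del: block_smul)
  ultimately have "((\<lambda>h::real. block y N k - block (act A_sym x) N k) \<longlongrightarrow> 0) (at_right 0)"
    by (simp only: diff_zero)
  then show "block y N k = block (act A_sym x) N k"
    by (simp add: tendsto_const_iff trivial_limit_at_right_real)
qed

section \<open>The resolvent on the imaginary axis\<close>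

text \<open>
  On block \<open>N\<close> the operator \<open>\<i> s - A\<close> is \<open>shift_coeff s N - \<nu> U\<close>, whose inverse is a geometric series.
\<close>

definition shift_coeff :: "real \<Rightarrow> nat \<Rightarrow> complex" where
  "shift_coeff s N = \<i> * of_real s - (\<i> - 1) * of_real (\<nu> N)"

definition R_sym :: "real \<Rightarrow> nat \<Rightarrow> complex fps" where
  "R_sym s N = Abs_fps (\<lambda>j. of_real (\<nu> N) ^ j / shift_coeff s N ^ Suc j)"

lemma Re_shift_coeff [simp]: "Re (shift_coeff s N) = \<nu> N"
  and Im_shift_coeff [simp]: "Im (shift_coeff s N) = s - \<nu> N"
  by (simp_all add: shift_coeff_def)

lemma nu_le_shift_coeff: "\<nu> N \<le> cmod (shift_coeff s N)"
  using complex_Re_le_cmod[of "shift_coeff s N"] by simp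

lemma shift_coeff_nonzero [simp]: "shift_coeff s N \<noteq> 0"
  using nu_le_shift_coeff[of N s] nu_pos[of N] by (metis norm_zero not_less)

lemma R_sym_inverse: "(fps_const (\<i> * of_real s) - A_sym N) * R_sym s N = 1"
proof -
  have "fps_const (\<i> * of_real s) - A_sym N
      = fps_const (shift_coeff s N) - fps_const (of_real (\<nu> N)) * fps_X"
    by (simp add: A_sym_def shift_coeff_def algebra_simps flip: fps_const_sub)
  moreover have "(fps_const (shift_coeff s N) - fps_const (of_real (\<nu> N)) * fps_X) * R_sym s N = 1"
  proof (rule fps_ext)
    fix n
    show "((fps_const (shift_coeff s N) - fps_const (of_real (\<nu> N)) * fps_X) * R_sym s N) $ n = 1 $ n"
      by (cases n) (simp_all add: left_diff_distrib mult.assoc R_sym_def)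
  qed
  ultimately show ?thesis by simp
qed

lemma A_R_sym: "A_sym N * R_sym s N = fps_const (\<i> * of_real s) * R_sym s N - 1"
  using R_sym_inverse[of s N] by (simp add: algebra_simps)

lemma norm_R_sym_nth: "cmod (R_sym s N $ j) = (\<nu> N / cmod (shift_coeff s N)) ^ j / cmod (shift_coeff s N)"
  by (simp add: R_sym_def norm_divide norm_mult norm_power power_divide)

text \<open>
  In the worst case, \<open>s = \<nu>\<close>, the coefficients are all equal to \<open>1 / \<nu>\<close>. The weighted sum then sees a
  geometric series of ratio \<open>1 / (1 + \<eta>)\<close>, and the supremum norm is controlled through
  \<open>act_coord_le_wsum\<close>; either way the result is of order \<open>1 / (\<nu> \<eta>) = \<nu>\<^sup>\<alpha>\<close>.
\<close>

lemma bnorm_R_le: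
  "bnorm N (block (act (R_sym s) f) N) \<le> 2 * \<nu> N powr \<alpha> * bnorm N (block f N)"
proof -
  have pw: "\<nu> N powr \<alpha> = 1 / (\<nu> N * \<eta> N)"
    by (simp add: nu_eta powr_minus_divide)
  have coeff: "cmod (R_sym s N $ j) \<le> 1 / \<nu> N" for j
  proof -
    have "(\<nu> N / cmod (shift_coeff s N)) ^ j \<le> 1"
      using nu_le_shift_coeff[of N s] by (intro power_le_one) (auto simp: divide_le_eq)
    then have "cmod (R_sym s N $ j) \<le> 1 / cmod (shift_coeff s N)"
      unfolding norm_R_sym_nth by (intro divide_right_mono) auto
    also have "\<dots> \<le> 1 / \<nu> N"
      using nu_le_shift_coeff[of N s] by (intro divide_left_mono) auto
    finally show ?thesis .
  qed
  have "cmod (block (act (R_sym s) f) N k) \<le> 2 * \<nu> N powr \<alpha> * bnorm N (block f N)" if k: "k \<le> K N" for k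
  proof -
    have "cmod (block (act (R_sym s) f) N k) \<le> 1 / \<nu> N / \<eta> N * wsum N (block f N)"
      using coeff k by (rule act_coord_le_wsum)
    also have "\<dots> = \<nu> N powr \<alpha> * wsum N (block f N)"
      by (simp add: pw)
    also have "\<dots> \<le> 2 * \<nu> N powr \<alpha> * bnorm N (block f N)"
      using bnorm_nonneg[of N "block f N"]
      by (intro mult_mono wsum_le_bnorm wsum_nonneg) auto
    finally show ?thesis .
  qed
  moreover have "wsum N (block (act (R_sym s) f) N) \<le> 2 * \<nu> N powr \<alpha> * bnorm N (block f N)"
  proof -
    have "(\<Sum>j\<le>m. cmod (R_sym s N $ j) / (1 + \<eta> N) ^ j) \<le> 2 * \<nu> N powr \<alpha>" for m
    proof -
      have "(\<Sum>j\<le>m. cmod (R_sym s N $ j) / (1 + \<eta> N) ^ j) \<le> (\<Sum>j\<le>m. 1 / \<nu> N * (1 / (1 + \<eta> N)) ^ j)"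
        unfolding power_divide using coeff
        by (intro sum_mono) (auto simp: divide_simps add_pos_nonneg intro!: mult_right_mono)
      also have "\<dots> = 1 / \<nu> N * (\<Sum>j\<le>m. (1 / (1 + \<eta> N)) ^ j)"
        by (simp add: sum_distrib_left)
      also have "\<dots> \<le> 1 / \<nu> N * (1 / (1 - 1 / (1 + \<eta> N)))"
        using eta_pos[of N] by (intro mult_left_mono sum_geometric_le) (auto simp: divide_less_eq)
      also have "1 / (1 - 1 / (1 + \<eta> N)) = (1 + \<eta> N) / \<eta> N"
      proof -
        have "1 + \<eta> N \<noteq> 0"
          using eta_pos[of N] by linarith
        then show ?thesis
          by (simp add: divide_simps)
      qed
      also have "1 / \<nu> N * ((1 + \<eta> N) / \<eta> N) = (1 + \<eta> N) * \<nu> N powr \<alpha>"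
        by (simp add: pw)
      also have "\<dots> \<le> 2 * \<nu> N powr \<alpha>"
        using eta_le_1[of N] by (intro mult_right_mono) auto
      finally show ?thesis .
    qed
    then have "wsum N (block (act (R_sym s) f) N) \<le> 2 * \<nu> N powr \<alpha> * wsum N (block f N)"
      by (rule wsum_act_le)
    also have "\<dots> \<le> 2 * \<nu> N powr \<alpha> * bnorm N (block f N)"
      by (intro mult_left_mono wsum_le_bnorm) auto
    finally show ?thesis .
  qed
  ultimately show ?thesis
    by (simp add: bnorm_le_iff)
qed

text \<open>
  At distance at least \<open>\<nu> / 2\<close> from the resonance, the modulus of \<open>\<nu> + \<i> (s - \<nu>)\<close> exceeds \<open>11/10 \<nu>\<close>,
  so the coefficients of the geometric series have a sum of order \<open>1 / \<nu>\<close>.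
\<close>

lemma bnorm_R_le_off_resonance:
  assumes "2 * \<bar>s\<bar> \<le> \<nu> N"
  shows "bnorm N (block (act (R_sym s) f) N) \<le> 10 * bnorm N (block f N)"
proof (rule bnorm_act_le_l1)
  let ?q = "cmod (shift_coeff s N)"
  have q: "11 / 10 * \<nu> N \<le> ?q"
  proof (rule power2_le_imp_le)
    have "(\<nu> N / 2)\<^sup>2 \<le> (s - \<nu> N)\<^sup>2"
      using assms nu_pos[of N] by (subst abs_le_square_iff[symmetric]) auto
    moreover have "?q\<^sup>2 = (\<nu> N)\<^sup>2 + (s - \<nu> N)\<^sup>2"
      by (simp add: cmod_power2)
    moreover have "0 \<le> (s - \<nu> N)\<^sup>2"
      by simp
    moreover have "(11 / 10 * \<nu> N)\<^sup>2 = 121 / 100 * (\<nu> N)\<^sup>2" "(\<nu> N / 2)\<^sup>2 = (\<nu> N)\<^sup>2 / 4"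
      by (simp_all add: power2_eq_square)
    ultimately show "(11 / 10 * \<nu> N)\<^sup>2 \<le> ?q\<^sup>2"
      by linarith
  qed auto
  have pos: "0 < ?q" "\<nu> N < ?q"
    using q nu_pos[of N] by linarith+
  have "(\<Sum>j\<le>K N. cmod (R_sym s N $ j)) = 1 / ?q * (\<Sum>j\<le>K N. (\<nu> N / ?q) ^ j)"
    by (simp add: norm_R_sym_nth sum_distrib_left)
  also have "\<dots> \<le> 1 / ?q * (1 / (1 - \<nu> N / ?q))"
    using pos by (intro mult_left_mono sum_geometric_le) auto
  also have "\<dots> = 1 / (?q - \<nu> N)"
    using pos by (simp add: field_simps)
  also have "\<dots> \<le> 1 / (1 / 10)"
    using q nu_ge_1[of N] by (intro divide_left_mono) auto
  finally show "(\<Sum>j\<le>K N. cmod (R_sym s N $ j)) \<le> 10"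
    by simp
qed

lemma bnorm_R_uniform:
  "bnorm N (block (act (R_sym s) f) N) \<le> (2 * (2 * \<bar>s\<bar>) powr \<alpha> + 10) * bnorm N (block f N)"
proof (cases "2 * \<bar>s\<bar> \<le> \<nu> N")
  case True
  have "10 * bnorm N (block f N) \<le> (2 * (2 * \<bar>s\<bar>) powr \<alpha> + 10) * bnorm N (block f N)"
    by (intro mult_right_mono bnorm_nonneg) auto
  then show ?thesis
    using bnorm_R_le_off_resonance[OF True, of f] by linarith
next
  case False
  then have "\<nu> N powr \<alpha> \<le> (2 * \<bar>s\<bar>) powr \<alpha>"
    using alpha_pos by (intro powr_mono2) auto
  then have "2 * \<nu> N powr \<alpha> * bnorm N (block f N) \<le> (2 * (2 * \<bar>s\<bar>) powr \<alpha> + 10) * bnorm N (block f N)"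
    by (intro mult_right_mono bnorm_nonneg) auto
  then show ?thesis
    using bnorm_R_le[of N s f] by linarith
qed

lemmas R_bounded = act_bounded[OF bnorm_R_uniform]

text \<open>
  On truncated vectors the identity is one of formal power series; it extends by closedness of the
  generator, because truncations commute with the resolvent and converge strongly.
\<close>

lemma generator_value_R:
  assumes y: "y \<in> vecs E"
  shows "has_generator_value E T (act (R_sym s) y) (smul E (\<i> * of_real s) (act (R_sym s) y) - y)"
proof -
  let ?x = "act (R_sym s) y" and ?z = "smul E (\<i> * of_real s) (act (R_sym s) y) - y"
  have x: "?x \<in> vecs E"
    using y by (rule R_bounded(1))
  have z: "?z \<in> vecs E"
    using x y by blast
  have eq: "act (\<lambda>N. A_sym N * trunc M N) ?x = act (trunc M) ?z" for M
  proof -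
    have "?z = act (\<lambda>N. fps_const (\<i> * of_real s) * R_sym s N - 1) y"
      using y by (simp add: act_diff_left act_smul_left vecs_supported del: fps_const_mult)
    also have "\<dots> = act (\<lambda>N. A_sym N * R_sym s N) y"
      by (simp only: A_R_sym)
    finally show ?thesis
      by (simp add: act_act mult_ac)
  qed
  show ?thesis
  proof (rule generator_closed[where M = 1 and u = "\<lambda>M. act (trunc M) ?x" and v = "\<lambda>M. act (trunc M) ?z"])
    show "has_generator_value E T (act (trunc M) ?x) (act (trunc M) ?z)" for M
      using generator_value_trunc[OF x, of M] unfolding eq .
  qed (intro C0_semigroup_T nrm_T_le trunc_vecs trunc_tendsto x z; assumption)+
qed

lemma R_generator_value:
  assumes x: "x \<in> vecs E" and y: "has_generator_value E T x y"
  shows "act (R_sym s) (smul E (\<i> * of_real s) x - y) = x"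
proof -
  have "smul E (\<i> * of_real s) x - y = act (\<lambda>N. fps_const (\<i> * of_real s) * 1 - A_sym N) x"
    unfolding generator_value_imp_act[OF x y] act_diff_left act_smul_left
    using x by (simp add: vecs_supported)
  then have "act (R_sym s) (smul E (\<i> * of_real s) x - y)
      = act (\<lambda>N. R_sym s N * (fps_const (\<i> * of_real s) * 1 - A_sym N)) x"
    by (simp add: act_act)
  also have "\<dots> = act (\<lambda>N. 1) x"
    using R_sym_inverse by (simp add: mult.commute)
  finally show ?thesis
    using x by (simp add: vecs_supported)
qed

lemma generator_domainD:
  assumes "x \<in> generator_domain E T"
  shows "x \<in> vecs E" "has_generator_value E T x (generator E T x)"
  using assms generator_eqI[OF C0_semigroup_T] by (auto simp: generator_domain_def)

lemma R_in_domain: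
  assumes "y \<in> vecs E"
  shows "act (R_sym s) y \<in> generator_domain E T"
    and "generator E T (act (R_sym s) y) = smul E (\<i> * of_real s) (act (R_sym s) y) - y"
  using generator_value_R[OF assms, of s] R_bounded(1)[OF assms, of s] generator_eqI[OF C0_semigroup_T]
  by (auto simp: generator_domain_def)

lemma generator_vecs: "x \<in> generator_domain E T \<Longrightarrow> generator E T x \<in> vecs E"
  using generator_domainD(2) by (auto simp: has_generator_value_def)

lemma resolvent_inverse:
  fixes s :: real
  defines "F \<equiv> \<lambda>x. smul E (\<i> * of_real s) x - generator E T x"
  shows "has_bounded_inverse E (generator_domain E T) F"
    and "y \<in> vecs E \<Longrightarrow> the_inv_into (generator_domain E T) F y = act (R_sym s) y"
proof -
  have B: "bounded_op E (act (R_sym s))"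
    by (rule R_bounded(3))
  have 1: "F (act (R_sym s) y) = y" if "y \<in> vecs E" for y
    using R_in_domain(2)[OF that, of s] by (simp add: F_def)
  have 2: "F x \<in> vecs E" if "x \<in> generator_domain E T" for x
    using that generator_domainD(1) generator_vecs by (simp add: F_def vecs_closed)
  have 3: "act (R_sym s) (F x) = x" if "x \<in> generator_domain E T" for x
    unfolding F_def by (rule R_generator_value[OF generator_domainD[OF that]])
  note * = bounded_inverseI[OF B R_in_domain(1) 1 2 3]
  show "has_bounded_inverse E (generator_domain E T) F"
    by (rule *(1))
  show "y \<in> vecs E \<Longrightarrow> the_inv_into (generator_domain E T) F y = act (R_sym s) y"
    by (rule *(2))
qed

lemma in_resolvent_set:
  "\<i> * complex_of_real s \<in> resolvent_set E (generator_domain E T) (generator E T)"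
  unfolding resolvent_set_def using resolvent_inverse(1) by simp

lemma op_norm_resolvent_le:
  "op_norm E (resolvent E (generator_domain E T) (generator E T) (\<i> * complex_of_real s))
    \<le> 2 * (2 * \<bar>s\<bar>) powr \<alpha> + 10"
proof (rule op_norm_le)
  fix x assume x: "x \<in> vecs E"
  have "\<bar>2 * (2 * \<bar>s\<bar>) powr \<alpha> + 10\<bar> = 2 * (2 * \<bar>s\<bar>) powr \<alpha> + 10"
    by (intro abs_of_nonneg add_nonneg_nonneg) auto
  then show "nrm E (resolvent E (generator_domain E T) (generator E T) (\<i> * complex_of_real s) x)
      \<le> (2 * (2 * \<bar>s\<bar>) powr \<alpha> + 10) * nrm E x"
    unfolding resolvent_def resolvent_inverse(2)[OF x] using R_bounded(2)[OF x, of s] by simp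
qed auto

lemma generator_inverse:
  shows "has_bounded_inverse E (generator_domain E T) (generator E T)"
    and "y \<in> vecs E \<Longrightarrow> the_inv_into (generator_domain E T) (generator E T) y = act (R_sym 0) (smul E (- 1) y)"
proof -
  have smul: "smul E (- 1) y = - y" for y
    by (simp add: E_simps(2) fun_eq_iff)
  have B: "bounded_op E (\<lambda>y. act (R_sym 0) (smul E (- 1) y))"
    by (intro bounded_op_smul R_bounded(3))
  have 0: "act (R_sym 0) (smul E (- 1) y) \<in> generator_domain E T" if "y \<in> vecs E" for y
    using that by (intro R_in_domain vecs_closed)
  have 1: "generator E T (act (R_sym 0) (smul E (- 1) y)) = y" if "y \<in> vecs E" for y
    using R_in_domain(2)[OF vecs_closed(4)[OF that], of 0 "- 1"] unfolding smul by simp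
  have 2: "act (R_sym 0) (smul E (- 1) (generator E T x)) = x" if "x \<in> generator_domain E T" for x
    using R_generator_value[OF generator_domainD[OF that], of 0] unfolding smul by simp
  note * = bounded_inverseI[OF B 0 1 generator_vecs 2]
  show "has_bounded_inverse E (generator_domain E T) (generator E T)"
    by (rule *(1))
  show "y \<in> vecs E \<Longrightarrow> the_inv_into (generator_domain E T) (generator E T) y = act (R_sym 0) (smul E (- 1) y)"
    by (rule *(2))
qed

section \<open>Slow decay of wave packets\<close>

text \<open>
  At the time \<open>\<tau>\<close> the Poisson distribution on block \<open>N\<close> has mean \<open>\<mu> = \<nu> \<tau>\<close>. The factor \<open>1/8\<close> makes
  \<open>exp (2 \<eta> \<mu>) = \<nu>\<^sup>1\<^sup>/\<^sup>4\<close>, a growth that the narrowness of the wave packet can compensate.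
\<close>

definition \<tau> :: "nat \<Rightarrow> real" where "\<tau> N = \<nu> N powr \<alpha> * ln (\<nu> N) / 8"

definition \<mu> :: "nat \<Rightarrow> real" where "\<mu> N = \<nu> N * \<tau> N"

definition bump :: "nat \<Rightarrow> real \<Rightarrow> complex" where
  "bump N = glue (\<lambda>M k. of_bool (M = N \<and> \<bar>real k - \<mu> N\<bar> \<le> sqrt (2 * \<mu> N)))"

lemma eta_mu: "\<eta> N * \<mu> N = ln (\<nu> N) / 8"
proof -
  have "\<eta> N * \<mu> N = (\<nu> N * \<eta> N) * \<nu> N powr \<alpha> * ln (\<nu> N) / 8"
    by (simp add: \<mu>_def \<tau>_def mult_ac)
  then show ?thesis
    by (simp add: nu_eta powr_add[symmetric])
qed

context
  fixes N :: nat
  assumes mu: "2 \<le> \<mu> N" and K: "2 * \<mu> N \<le> real (K N)"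
begin

lemma window_bound:
  assumes "\<bar>real k - \<mu> N\<bar> \<le> sqrt (2 * \<mu> N)"
  shows "real k \<le> 2 * \<mu> N" "k \<le> K N"
proof -
  have "sqrt (2 * \<mu> N) \<le> \<mu> N"
    using mu by (intro real_le_lsqrt) (auto simp: power2_eq_square)
  then show *: "real k \<le> 2 * \<mu> N"
    using assms by linarith
  then show "k \<le> K N"
    using K by linarith
qed

lemma block_bump: "block (bump N) M = (\<lambda>k. of_bool (M = N \<and> \<bar>real k - \<mu> N\<bar> \<le> sqrt (2 * \<mu> N)))"
  by (rule ext) (simp add: bump_def)

lemma supported_bump: "supported (bump N)"
  using window_bound(2) by (auto simp: supported_def block_bump not_le[symmetric]) (simp add: bump_def glue_outside)

text \<open>
  On the window the weights are at most \<open>exp (2 \<eta> \<mu>) = \<nu>\<^sup>1\<^sup>/\<^sup>4\<close>, and the window has at most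
  \<open>3 sqrt (2 \<mu>)\<close> points. Since \<open>(\<eta> sqrt (2 \<mu>))\<^sup>2 = \<eta> log \<nu> / 4\<close> and \<open>\<eta> \<le> 1 / \<nu>\<close>, the factor
  \<open>\<eta> sqrt (2 \<mu>)\<close> is at most \<open>\<nu>\<^sup>-\<^sup>1\<^sup>/\<^sup>4\<close>.
\<close>

lemma wsum_bump_le: "wsum N (block (bump N) N) \<le> 3"
proof -
  let ?d = "sqrt (2 * \<mu> N)"
  let ?W = "{k::nat. \<bar>real k - \<mu> N\<bar> \<le> ?d}"
  have d: "2 \<le> ?d"
    using mu by (intro real_le_rsqrt) (auto simp: power2_eq_square)
  have pow: "(1 + \<eta> N) ^ k \<le> \<nu> N powr (1 / 4)" if "k \<in> ?W" for k
  proof -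
    have "(1 + \<eta> N) ^ k \<le> exp (\<eta> N) ^ k"
      by (intro power_mono exp_ge_add_one_self) (auto intro: add_nonneg_nonneg)
    also have "\<dots> = exp (real k * \<eta> N)"
      by (rule exp_of_nat_mult[symmetric])
    also have "\<dots> \<le> exp (2 * \<mu> N * \<eta> N)"
      using window_bound(1) that by (simp add: mult_right_mono)
    also have "2 * \<mu> N * \<eta> N = 1 / 4 * ln (\<nu> N)"
      using eta_mu[of N] by (simp add: mult_ac)
    also have "exp \<dots> = \<nu> N powr (1 / 4)"
      by (simp add: powr_def)
    finally show ?thesis .
  qed
  have sq: "\<eta> N * ?d \<le> \<nu> N powr (- 1 / 4)"
  proof (rule power2_le_imp_le)
    have "ln (\<nu> N) \<le> 4 * \<nu> N powr (1 / 2)"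
      using ln_le_minus_one[of "\<nu> N powr (1 / 2)"] nu_pos[of N] powr_ge_zero[of "\<nu> N" "1 / 2"]
        ln_powr[of "\<nu> N" "1 / 2"] by (simp del: powr_ge_zero)
    have "(\<eta> N * ?d)\<^sup>2 = 2 * \<eta> N * (\<eta> N * \<mu> N)"
      using mu by (simp add: power_mult_distrib power2_eq_square)
    also have "\<dots> = \<eta> N * (ln (\<nu> N) / 4)"
      by (simp add: eta_mu)
    also have "\<dots> \<le> \<nu> N powr (- 1) * \<nu> N powr (1 / 2)"
    proof (intro mult_mono)
      show "\<eta> N \<le> \<nu> N powr - 1"
        unfolding \<eta>_def using nu_ge_1[of N] alpha_pos by (intro powr_mono) auto
      show "ln (\<nu> N) / 4 \<le> \<nu> N powr (1 / 2)"
        using \<open>ln (\<nu> N) \<le> _\<close> by simp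
      show "0 \<le> ln (\<nu> N) / 4"
        using nu_ge_1[of N] by simp
    qed auto
    also have "\<dots> = (\<nu> N powr (- 1 / 4))\<^sup>2"
      by (simp only: power2_eq_square powr_add[symmetric]) simp
    finally show "(\<eta> N * ?d)\<^sup>2 \<le> (\<nu> N powr (- 1 / 4))\<^sup>2" .
  qed auto
  have "(\<Sum>k\<le>K N. (1 + \<eta> N) ^ k * cmod (block (bump N) N k)) = (\<Sum>k\<in>?W. (1 + \<eta> N) ^ k)"
    using window_bound(2) by (intro sum.mono_neutral_cong_right) (auto simp: block_bump)
  also have "\<dots> \<le> (\<Sum>k\<in>?W. \<nu> N powr (1 / 4))"
    by (intro sum_mono pow)
  also have "\<dots> = real (card ?W) * \<nu> N powr (1 / 4)"
    by simp
  also have "\<dots> \<le> (3 * ?d) * \<nu> N powr (1 / 4)"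
  proof (rule mult_right_mono)
    have "real (card ?W) \<le> 2 * ?d + 1"
      using d by (intro card_nat_window_le) linarith
    then show "real (card ?W) \<le> 3 * ?d"
      using d by linarith
  qed simp
  finally have "wsum N (block (bump N) N) \<le> \<eta> N * ((3 * ?d) * \<nu> N powr (1 / 4))"
    unfolding wsum_def by (intro mult_left_mono) auto
  also have "\<dots> = 3 * ((\<eta> N * ?d) * \<nu> N powr (1 / 4))"
    by simp
  also have "\<dots> \<le> 3 * (\<nu> N powr (- 1 / 4) * \<nu> N powr (1 / 4))"
    by (intro mult_left_mono mult_right_mono sq) auto
  also have "\<dots> = 3"
    by (simp add: powr_add[symmetric])
  finally show ?thesis .
qed

lemma bnorm_bump: "bnorm M (block (bump N) M) \<le> (if M = N then 3 else 0)"
proof (cases "M = N")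
  case True
  then show ?thesis
    using wsum_bump_le by (auto simp: bnorm_le_iff) (simp add: block_bump)
next
  case False
  then show ?thesis
    by (simp add: block_bump)
qed

lemma bump_vecs: "bump N \<in> vecs E"
proof -
  have "\<forall>\<^sub>F M in sequentially. bnorm M (block (bump N) M) = 0"
    using eventually_gt_at_top[of N] by eventually_elim (simp add: block_bump)
  then show ?thesis
    by (simp add: E_simps supported_bump tendsto_eventually)
qed

lemma generator_value_bump: "has_generator_value E T (bump N) (act A_sym (bump N))"
proof -
  have "act (trunc N) (bump N) = act (\<lambda>M. 1) (bump N)"
    by (rule act_eqI) (simp add: block_act block_bump trunc_def)
  then have tr: "act (trunc N) (bump N) = bump N"
    by (simp add: supported_bump)
  then have "act (\<lambda>M. A_sym M * trunc N M) (bump N) = act A_sym (bump N)"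
    by (simp flip: act_act)
  then show ?thesis
    using generator_value_trunc[OF bump_vecs, of N] tr by simp
qed

lemma nrm_A_bump_le: "nrm E (act A_sym (bump N)) \<le> 9 * \<nu> N"
proof (rule nrm_le)
  fix M
  have "(\<Sum>j\<le>K M. cmod (A_sym M $ j)) \<le> 3 * \<nu> M"
  proof -
    have "(\<Sum>j\<le>K M. cmod (A_sym M $ j)) \<le> (\<Sum>j\<in>{0, 1} \<union> {..K M}. cmod (A_sym M $ j))"
      by (intro sum_mono2) auto
    also have "\<dots> = (\<Sum>j\<in>{0, 1}. cmod (A_sym M $ j))"
      by (intro sum.mono_neutral_right) (auto simp: A_sym_def)
    also have "\<dots> = cmod (\<i> - 1) * \<nu> M + \<nu> M"
      by (simp add: A_sym_def norm_mult)
    also have "cmod (\<i> - 1) \<le> 2"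
      using norm_triangle_ineq4[of \<i> 1] by simp
    finally show ?thesis by simp
  qed
  then have "bnorm M (block (act A_sym (bump N)) M) \<le> 3 * \<nu> M * bnorm M (block (bump N) M)"
    by (rule bnorm_act_le_l1)
  also have "\<dots> \<le> 3 * \<nu> M * (if M = N then 3 else 0)"
    by (intro mult_left_mono bnorm_bump) auto
  also have "\<dots> \<le> 9 * \<nu> N"
    by simp
  finally show "bnorm M (block (act A_sym (bump N)) M) \<le> 9 * \<nu> N" .
qed

text \<open>
  Apart from a rotation, the coordinate 0 at time \<open>\<tau>\<close> is the probability of the window under the
  Poisson distribution with mean \<open>\<mu>\<close>.
\<close>

lemma nrm_T_bump_ge: "1 / 2 \<le> nrm E (T (\<tau> N) (bump N))"
proof -
  have t: "0 \<le> \<tau> N"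
    using nu_ge_1[of N] by (simp add: \<tau>_def)
  have "block (T (\<tau> N) (bump N)) N 0 = exp ((\<i> - 1) * of_real (\<mu> N))
      * of_real (\<Sum>k\<le>K N. \<mu> N ^ k / fact k * of_bool (\<bar>real k - \<mu> N\<bar> \<le> sqrt (2 * \<mu> N)))"
    by (simp add: block_act block_bump T_sym_nth \<mu>_def sum_distrib_left mult_ac of_bool_def if_distrib cong: if_cong)
  moreover have "0 \<le> (\<Sum>k\<le>K N. \<mu> N ^ k / fact k * of_bool (\<bar>real k - \<mu> N\<bar> \<le> sqrt (2 * \<mu> N)))"
    using mu by (intro sum_nonneg) auto
  ultimately have "cmod (block (T (\<tau> N) (bump N)) N 0)
      = exp (- \<mu> N) * (\<Sum>k\<le>K N. \<mu> N ^ k / fact k * of_bool (\<bar>real k - \<mu> N\<bar> \<le> sqrt (2 * \<mu> N)))"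
    by (simp only: norm_mult norm_exp_eq_Re norm_of_real abs_of_nonneg) simp
  then have "1 / 2 \<le> cmod (block (T (\<tau> N) (bump N)) N 0)"
    using poisson_window_ge_half[of "\<mu> N" "K N"] window_bound(2) mu by simp
  also have "\<dots> \<le> bnorm N (block (T (\<tau> N) (bump N)) N)"
    by (rule norm_le_bnorm) simp
  also have "\<dots> \<le> nrm E (T (\<tau> N) (bump N))"
    using t bump_vecs by (intro bnorm_le_nrm T_vecs)
  finally show ?thesis .
qed

lemma op_norm_T_inverse_ge:
  "1 / (18 * \<nu> N) \<le> op_norm E (\<lambda>x. T (\<tau> N) (the_inv_into (generator_domain E T) (generator E T) x))"
    (is "_ \<le> op_norm E ?B")
proof -
  let ?D = "generator_domain E T" and ?A = "generator E T"
  have t: "0 \<le> \<tau> N"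
    using nu_ge_1[of N] by (simp add: \<tau>_def)
  have dom: "bump N \<in> ?D" and A: "?A (bump N) = act A_sym (bump N)"
    using generator_value_bump bump_vecs generator_eqI[OF C0_semigroup_T bump_vecs generator_value_bump]
    unfolding generator_domain_def by blast+
  have inv: "has_bounded_inverse E ?D ?A"
    by (rule generator_inverse(1))
  have "bounded_op E (T (\<tau> N))"
    using C0_semigroup_T t by (simp add: C0_semigroup_def)
  moreover have "bounded_op E (the_inv_into ?D ?A)"
    using inv by (simp add: has_bounded_inverse_def)
  ultimately have B: "bounded_op E ?B"
    by (rule bounded_op_compose)
  have "the_inv_into ?D ?A (?A (bump N)) = bump N"
    using inv dom by (intro the_inv_into_f_f) (auto simp: has_bounded_inverse_def bij_betw_def)
  then have "1 / 2 \<le> op_norm E ?B * nrm E (?A (bump N))"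
    using le_op_norm[OF B, of "?A (bump N)"] generator_vecs[OF dom] nrm_T_bump_ge by simp
  also have "\<dots> \<le> op_norm E ?B * (9 * \<nu> N)"
    unfolding A by (intro mult_left_mono nrm_A_bump_le op_norm_nonneg B)
  finally have "1 / 2 \<le> op_norm E ?B * (9 * \<nu> N)" .
  then show ?thesis
    using nu_pos[of N] by (simp add: field_simps)
qed

end

end

section \<open>Optimality of the logarithmic decay rate\<close>

theorem theorem4p1:
  fixes \<alpha> :: real
  assumes "\<alpha> > 0"
  shows "\<exists>(E :: (real \<Rightarrow> complex) cspace) T D A.
    complex_banach_space E \<and>
    bounded_C0_semigroup E T \<and>
    D = generator_domain E T \<and> A = generator E T \<and>
    (\<forall>s::real. \<i> * complex_of_real s \<in> resolvent_set E D A) \<and>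
    (\<lambda>s::real. op_norm E (resolvent E D A (\<i> * complex_of_real s)))
      \<in> O[at_infinity](\<lambda>s. \<bar>s\<bar> powr \<alpha>) \<and>
    has_bounded_inverse E D A \<and>
    Limsup at_top (\<lambda>t::real. ereal ((t / ln t) powr (1 / \<alpha>) *
      op_norm E (\<lambda>x. T t (the_inv_into D A x)))) > 0"
proof -
  \<comment> \<open>Blocks of length twice the Poisson mean contain the whole window.\<close>
  define K where "K N = nat \<lceil>2 * (real (Suc N) * (real (Suc N) powr \<alpha> * ln (real (Suc N)) / 8))\<rceil>" for N
  interpret shift_blocks \<alpha> K
    using assms by unfold_locales
  have K: "2 * \<mu> N \<le> real (K N)" for N
    unfolding K_def \<mu>_def \<tau>_def \<nu>_def by (rule real_nat_ceiling_ge)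
  let ?D = "generator_domain E T" and ?A = "generator E T"
  have O: "(\<lambda>s. op_norm E (resolvent E ?D ?A (\<i> * complex_of_real s))) \<in> O[at_infinity](\<lambda>s. \<bar>s\<bar> powr \<alpha>)"
  proof (rule bigoI)
    have "\<forall>\<^sub>F s::real in at_infinity. 1 \<le> norm s"
      by (auto simp: eventually_at_infinity)
    then show "\<forall>\<^sub>F s in at_infinity. norm (op_norm E (resolvent E ?D ?A (\<i> * complex_of_real s)))
        \<le> (2 * 2 powr \<alpha> + 10) * norm (\<bar>s\<bar> powr \<alpha>)"
    proof eventually_elim
      case (elim s)
      have "1 \<le> \<bar>s\<bar> powr \<alpha>"
        using elim assms by (intro ge_one_powr_ge_zero) auto
      then have "2 * (2 * \<bar>s\<bar>) powr \<alpha> + 10 \<le> (2 * 2 powr \<alpha> + 10) * \<bar>s\<bar> powr \<alpha>"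
        by (simp add: powr_mult algebra_simps)
      moreover have "0 \<le> op_norm E (resolvent E ?D ?A (\<i> * complex_of_real s))"
        using in_resolvent_set[of s]
        by (intro op_norm_nonneg) (simp add: resolvent_set_def has_bounded_inverse_def resolvent_def)
      ultimately show ?case
        using op_norm_resolvent_le[of s] by simp
    qed
  qed
  define f where "f t = (t / ln t) powr (1 / \<alpha>) * op_norm E (\<lambda>x. T t (the_inv_into ?D ?A x))" for t
  define c where "c = (1 / (8 * (1 + \<alpha>))) powr (1 / \<alpha>) / 18"
  have c: "0 < c"
    using assms by (simp add: c_def)
  have lim: "filterlim \<tau> at_top sequentially"
  proof (rule filterlim_at_top_mono)
    show "filterlim (\<lambda>N. 1 / 8 * ln (real (Suc N))) at_top sequentially"
      by (intro filterlim_tendsto_pos_mult_at_top[OF tendsto_const] filterlim_compose[OF ln_at_top]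
          filterlim_compose[OF filterlim_real_sequentially filterlim_Suc]) auto
    have "1 / 8 * ln (\<nu> N) \<le> \<tau> N" for N
      using mult_right_mono[of 1 "\<nu> N powr \<alpha>" "ln (\<nu> N) / 8"] ge_one_powr_ge_zero[OF nu_ge_1, of \<alpha> N]
        nu_ge_1[of N] assms by (simp add: \<tau>_def)
    then show "\<forall>\<^sub>F N in sequentially. 1 / 8 * ln (real (Suc N)) \<le> \<tau> N"
      by (simp add: \<nu>_def)
  qed
  \<comment> \<open>Here \<open>ln \<tau> \<le> (1 + \<alpha>) ln \<nu>\<close>, so \<open>(\<tau> / ln \<tau>)\<^sup>1\<^sup>/\<^sup>\<alpha>\<close> is at least a constant multiple of \<open>\<nu>\<close>.\<close>
  have lower: "c \<le> f (\<tau> N)" if t: "1 < \<tau> N" and N: "1 \<le> N" for N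
  proof -
    have nu: "2 \<le> \<nu> N"
      using N by (simp add: \<nu>_def)
    have L: "0 < ln (\<nu> N)"
      using nu by simp
    have "1 * 2 \<le> \<tau> N * \<nu> N"
      using t nu by (intro mult_mono) auto
    then have mu: "2 \<le> \<mu> N"
      by (simp add: \<mu>_def mult.commute)
    have "ln (\<tau> N) = \<alpha> * ln (\<nu> N) + ln (ln (\<nu> N) / 8)"
      using L by (simp add: \<tau>_def ln_mult ln_powr ln_div)
    also have "ln (ln (\<nu> N) / 8) \<le> ln (\<nu> N)"
      using ln_le_minus_one[OF divide_pos_pos[OF L, of 8]] L by linarith
    finally have ln: "ln (\<tau> N) \<le> (1 + \<alpha>) * ln (\<nu> N)"
      by (simp add: algebra_simps)
    have "1 / (8 * (1 + \<alpha>)) * \<nu> N powr \<alpha> = \<tau> N / ((1 + \<alpha>) * ln (\<nu> N))"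
    proof -
      have "1 + \<alpha> \<noteq> 0"
        using assms by simp
      then show ?thesis
        using L by (simp add: \<tau>_def divide_simps)
    qed
    also have "\<dots> \<le> \<tau> N / ln (\<tau> N)"
      using ln t L assms by (intro divide_left_mono mult_pos_pos) auto
    finally have "(1 / (8 * (1 + \<alpha>)) * \<nu> N powr \<alpha>) powr (1 / \<alpha>) \<le> (\<tau> N / ln (\<tau> N)) powr (1 / \<alpha>)"
      using assms by (intro powr_mono2) auto
    moreover have "(1 / (8 * (1 + \<alpha>)) * \<nu> N powr \<alpha>) powr (1 / \<alpha>) = 18 * c * \<nu> N"
      using assms nu unfolding c_def by (subst powr_mult) (auto simp: powr_powr)
    ultimately have 1: "18 * c * \<nu> N \<le> (\<tau> N / ln (\<tau> N)) powr (1 / \<alpha>)"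
      by simp
    have "c = (18 * c * \<nu> N) * (1 / (18 * \<nu> N))"
      by simp
    also have "\<dots> \<le> f (\<tau> N)"
      unfolding f_def using c by (intro mult_mono 1 op_norm_T_inverse_ge[OF mu K]) auto
    finally show ?thesis .
  qed
  have "0 < Limsup at_top (\<lambda>t. ereal (f t))"
  proof (rule ccontr)
    assume "\<not> 0 < Limsup at_top (\<lambda>t. ereal (f t))"
    then have "Limsup at_top (\<lambda>t. ereal (f t)) < ereal c"
      using c by (simp add: not_less le_less_trans)
    then have "\<forall>\<^sub>F t in at_top. ereal (f t) < ereal c"
      by (rule Limsup_lessD)
    then have "\<forall>\<^sub>F N in sequentially. ereal (f (\<tau> N)) < ereal c"
      using lim by (rule eventually_compose_filterlim)
    moreover have "\<forall>\<^sub>F N in sequentially. 1 < \<tau> N"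
      using lim by (simp add: filterlim_at_top_dense)
    ultimately have "\<forall>\<^sub>F N in sequentially. False"
      using eventually_ge_at_top[of 1] by eventually_elim (use lower in fastforce)
    then show False
      by simp
  qed
  then have "complex_banach_space E \<and> bounded_C0_semigroup E T \<and> ?D = generator_domain E T \<and> ?A = generator E T \<and>
    (\<forall>s::real. \<i> * complex_of_real s \<in> resolvent_set E ?D ?A) \<and>
    (\<lambda>s::real. op_norm E (resolvent E ?D ?A (\<i> * complex_of_real s))) \<in> O[at_infinity](\<lambda>s. \<bar>s\<bar> powr \<alpha>) \<and>
    has_bounded_inverse E ?D ?A \<and>
    Limsup at_top (\<lambda>t::real. ereal ((t / ln t) powr (1 / \<alpha>) *
      op_norm E (\<lambda>x. T t (the_inv_into ?D ?A x)))) > 0"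
    using O bounded_C0_semigroup_T in_resolvent_set generator_inverse(1) complex_banach_space_axioms
    by (simp add: f_def)
  then show ?thesis
    by blast
qed

end
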